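(* Let $A,Y$ be finite sets, $v:Y\to\mathbb{R}$, $k^*,k'\in\mathbb{N}=\{0,1,2,\dots\}$ with $k^*\neq k'$, and let $F^*\in(\Delta(Y))^A$ be such that $a\mapsto\sum_{y\in Y}v(y)F^*(y|a)$ has a unique maximizer $a^*$ over $A$. Suppose that either $\delta\in(0,1)$, or $\delta=0$ and $k'=0$, and that the prior $\pi_0$ is regular with respect to $F^*$. Then for every $\sigma\in\Sigma^*(\pi_0)$: if, under $\sigma$ and the true process, $a_t$ converges to some $a\in A$ with positive probability, then $a=a^*$. Furthermore, $$\liminf_{t\to+\infty}\mathbb{E}^{\sigma}\Big[\frac1t\sum_{s=1}^t\mathbf{1}\{a_s=a^*\}\Big]>0\quad\text{for every }\sigma\in\Sigma^*(\pi_0).$$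
   Context: $\Delta(Y)$ is the set of probability distributions on the finite set $Y$. A state is $F=\{F(\cdot|a)\}_{a\in A}\in\mathcal{Y}:=(\Delta(Y))^A$. Time is discrete, $t=1,2,\dots$. In period $t$ an agent chooses $a_t\in A$ and then observes an outcome $y_t\in Y$. The actions $a_0,a_{-1},a_{-2},\dots$ before period 1 are exogenously given. In period $t$ the agent knows the history $h^t=\{\dots,a_{-1},a_0,a_1,\dots,a_{t-1},y_1,\dots,y_{t-1}\}$; $\mathcal{H}$ is the set of all histories, and a strategy is a map $\sigma:\mathcal{H}\to\Delta(A)$. True process: given the true state $F^*$, conditional on the past, $y_t$ is distributed according to $F^*(\cdot|a_{t-k^*})$. $\mathbb{E}^{\sigma}$ denotes expectation under this true process when the agent uses $\sigma$. Agent's subjective (misspecified) model: the agent has a prior $\pi_0$ with finite support on $\mathcal{Y}$ and believes that, if the state is $F$, then conditional on the past $y_t$ is distributed according to $F(\cdot|a_{t-k'})$. The agent updates beliefs by Bayes' rule under this subjective model. $\Sigma^*(\pi_0)$ is the set of strategies $\sigma$ that are optimal, i.e. such that at every history $h^t$ the strategy maximizes the subjective conditional expectation of $\sum_{s=0}^{\infty}\delta^s v(y_{t+s})$ given $h^t$. Regular prior: $\pi_0$ (with finite support) is regular with respect to $F^*$ if (1) $F^*\in\mathrm{supp}(\pi_0)$, and for every $F\in\mathrm{supp}(\pi_0)$ and $a\in A$ the distribution $F(\cdot|a)$ has full support on $Y$; (2) for all distinct $F,F'\in\mathrm{supp}(\pi_0)$ and every $a\in A$, $F(\cdot|a)\neq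 F'(\cdot|a)$. *)

theory Defs
  imports "HOL-Probability.Probability"
begin

text \<open>The finite sets of actions and of outcomes are finite types.\<close>

type_synonym ('a, 'y) state = "'a \<Rightarrow> 'y pmf"

text \<open>
  A history at the beginning of period $t$ is a pair $(e, xs)$: the exogenous action of period
  $-i$ is $e\,i$, and $xs = [(a_1, y_1), \ldots, (a_{t-1}, y_{t-1})]$.
\<close>

type_synonym ('a, 'y) history = "(nat \<Rightarrow> 'a) \<times> ('a \<times> 'y) list"

type_synonym ('a, 'y) strategy = "('a, 'y) history \<Rightarrow> 'a pmf"

text \<open>The action taken in the (possibly nonpositive) period \<open>j\<close>.\<close>

definition action_at :: "('a, 'y) history \<Rightarrow> int \<Rightarrow> 'a" where
  "action_at h j = (if j \<le> 0 then fst h (nat (- j)) else fst (snd h ! (nat j - 1)))"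

definition current_period :: "('a, 'y) history \<Rightarrow> nat" where
  "current_period h = length (snd h) + 1"

text \<open>
  The action $a_{t-k}$ when $t$ is the current period and \<open>a\<close> is the action chosen in it;
  that action is not yet part of the history, which matters for $k = 0$.
\<close>

definition lagged_action :: "nat \<Rightarrow> ('a, 'y) history \<Rightarrow> 'a \<Rightarrow> 'a" where
  "lagged_action k h a =
     (if k = 0 then a else action_at h (int (current_period h) - int k))"

definition next_period ::
    "('a, 'y) state \<Rightarrow> nat \<Rightarrow> ('a, 'y) strategy \<Rightarrow> ('a, 'y) history \<Rightarrow> ('a \<times> 'y) pmf" where
  "next_period F k \<sigma> h =
     bind_pmf (\<sigma> h) (\<lambda>a. map_pmf (\<lambda>y. (a, y)) (F (lagged_action k h a)))"

text \<open>The history reached from \<open>h\<close> after the first \<open>n\<close> periods of the continuation path \<open>\<omega>\<close>.\<close>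

definition extend_history ::
    "('a, 'y) history \<Rightarrow> (nat \<Rightarrow> 'a \<times> 'y) \<Rightarrow> nat \<Rightarrow> ('a, 'y) history" where
  "extend_history h \<omega> n = (fst h, snd h @ map \<omega> [0..<n])"

abbreviation step_kernel ::
    "('a, 'y) state \<Rightarrow> nat \<Rightarrow> ('a, 'y) strategy \<Rightarrow> ('a, 'y) history \<Rightarrow>
     nat \<Rightarrow> (nat \<Rightarrow> 'a \<times> 'y) \<Rightarrow> ('a \<times> 'y) measure" where
  "step_kernel F k \<sigma> h n \<omega> \<equiv> measure_pmf (next_period F k \<sigma> (extend_history h \<omega> n))"

text \<open>
  The law of the continuation path after \<open>h\<close> when outcomes are generated by the state \<open>F\<close> with
  lag \<open>k\<close> and the agent uses \<open>\<sigma>\<close>: the Ionescu-Tulcea measure of the one-period kernels. If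
  period $t$ is the current period at \<open>h\<close>, then $\omega\,n = (a_{t+n}, y_{t+n})$.
\<close>

definition path_measure ::
    "('a, 'y) state \<Rightarrow> nat \<Rightarrow> ('a, 'y) strategy \<Rightarrow> ('a, 'y) history \<Rightarrow>
     (nat \<Rightarrow> 'a \<times> 'y) measure" where
  "path_measure F k \<sigma> h =
     projective_family.lim UNIV
       (Ionescu_Tulcea.CI (step_kernel F k \<sigma> h) (\<lambda>_. count_space UNIV))
       (\<lambda>_. count_space UNIV)"

lemma measurable_map_upt:
  "(\<lambda>\<omega>. map \<omega> [0..<n]) \<in>
     measurable (PiM {0..<n} (\<lambda>_. count_space (UNIV :: 'b::finite set))) (count_space UNIV)"
proof -
  let ?M = "PiM {0..<n} (\<lambda>_. count_space (UNIV :: 'b set))"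
  have "(\<lambda>\<omega>. map \<omega> [0..<n]) -` {xs} \<inter> space ?M \<in> sets ?M" for xs :: "'b list"
  proof (cases "length xs = n")
    case True
    have "(\<lambda>\<omega>. map \<omega> [0..<n]) -` {xs} \<inter> space ?M = PiE {0..<n} (\<lambda>i. {xs ! i})"
    proof (rule set_eqI)
      fix \<omega> :: "nat \<Rightarrow> 'b"
      have "map \<omega> [0..<n] = xs \<longleftrightarrow> (\<forall>i<n. \<omega> i = xs ! i)"
        using True by (simp add: list_eq_iff_nth_eq)
      then show "\<omega> \<in> (\<lambda>\<omega>. map \<omega> [0..<n]) -` {xs} \<inter> space ?M \<longleftrightarrow>
          \<omega> \<in> PiE {0..<n} (\<lambda>i. {xs ! i})"
        by (simp add: space_PiM PiE_iff Ball_def conj_commute)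
    qed
    then show ?thesis by (simp only:) (rule sets_PiM_I_finite, simp_all)
  next
    case False
    then have "(\<lambda>\<omega>. map \<omega> [0..<n]) -` {xs} = {}" by auto
    then show ?thesis by (simp only: Int_empty_left sets.empty_sets)
  qed
  then show ?thesis
    by (simp only: measurable_count_space_eq2_countable UNIV_I countableI_type) simp
qed

lemma Ionescu_Tulcea_step_kernel:
  fixes F :: "('a::finite, 'y::finite) state"
  shows "Ionescu_Tulcea (step_kernel F k \<sigma> h) (\<lambda>_. count_space UNIV)"
proof
  fix n
  have "(\<lambda>xs. measure_pmf (next_period F k \<sigma> (fst h, snd h @ xs))) \<in>
          measurable (count_space UNIV) (subprob_algebra (count_space UNIV))"
    by (rule measurable_count_space_eq1[THEN iffD2])
       (auto simp: space_subprob_algebra measure_pmf.subprob_space_axioms)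
  from measurable_compose[OF measurable_map_upt this]
  show "step_kernel F k \<sigma> h n \<in>
          measurable (PiM {0..<n} (\<lambda>_. count_space UNIV)) (subprob_algebra (count_space UNIV))"
    unfolding extend_history_def .
qed

lemma prob_space_path_measure:
  fixes F :: "('a::finite, 'y::finite) state"
  shows "prob_space (path_measure F k \<sigma> h)"
proof -
  interpret Ionescu_Tulcea "step_kernel F k \<sigma> h" "\<lambda>_. count_space UNIV"
    by (rule Ionescu_Tulcea_step_kernel)
  have "emeasure PF.lim (PF.emb UNIV {} (space (PiM {} (\<lambda>_. count_space UNIV)))) = 1"
    using prob_space.emeasure_space_1[OF PF.prob_space_P, of "{}"]
    by (subst lim) (simp_all add: PF.space_P)
  moreover have "PF.emb UNIV {} (space (PiM {} (\<lambda>_. count_space UNIV))) = space PF.lim"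
    by (simp add: prod_emb_def space_PiM restrict_def)
  ultimately show ?thesis
    unfolding path_measure_def by (intro prob_spaceI) simp
qed

definition expected_payoff :: "('y \<Rightarrow> real) \<Rightarrow> ('a, 'y) state \<Rightarrow> 'a \<Rightarrow> real" where
  "expected_payoff v F a = (\<Sum>y\<in>UNIV. v y * pmf (F a) y)"

text \<open>
  Probability of the outcomes recorded in \<open>h\<close>, given the actions, in state \<open>F\<close> with lag \<open>k\<close>.
  The choice probabilities of the strategy do not depend on the state and cancel in Bayes' rule.
\<close>

definition likelihood :: "nat \<Rightarrow> ('a, 'y) history \<Rightarrow> ('a, 'y) state \<Rightarrow> real" where
  "likelihood k h F =
     (\<Prod>s = 1..length (snd h). pmf (F (action_at h (int s - int k))) (snd (snd h ! (s - 1))))"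

definition posterior ::
    "('a, 'y) state pmf \<Rightarrow> nat \<Rightarrow> ('a, 'y) history \<Rightarrow> ('a, 'y) state \<Rightarrow> real" where
  "posterior \<pi>\<^sub>0 k h F =
     pmf \<pi>\<^sub>0 F * likelihood k h F / (\<Sum>G\<in>set_pmf \<pi>\<^sub>0. pmf \<pi>\<^sub>0 G * likelihood k h G)"

definition subjective_value ::
    "real \<Rightarrow> ('y \<Rightarrow> real) \<Rightarrow> nat \<Rightarrow> ('a, 'y) state pmf \<Rightarrow> ('a, 'y) strategy \<Rightarrow>
     ('a, 'y) history \<Rightarrow> real" where
  "subjective_value \<delta> v k \<pi>\<^sub>0 \<sigma> h =
     (\<Sum>F\<in>set_pmf \<pi>\<^sub>0. posterior \<pi>\<^sub>0 k h F *
        (\<integral>\<omega>. (\<Sum>s. \<delta> ^ s * v (snd (\<omega> s))) \<partial>path_measure F k \<sigma> h))"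

definition optimal_strategies ::
    "real \<Rightarrow> ('y \<Rightarrow> real) \<Rightarrow> nat \<Rightarrow> ('a, 'y) state pmf \<Rightarrow> ('a, 'y) strategy set" where
  "optimal_strategies \<delta> v k \<pi>\<^sub>0 =
     {\<sigma>. \<forall>h \<sigma>'. subjective_value \<delta> v k \<pi>\<^sub>0 \<sigma>' h \<le> subjective_value \<delta> v k \<pi>\<^sub>0 \<sigma> h}"

definition regular_prior :: "('a, 'y) state \<Rightarrow> ('a, 'y) state pmf \<Rightarrow> bool" where
  "regular_prior F\<^sub>s \<pi>\<^sub>0 \<longleftrightarrow>
     finite (set_pmf \<pi>\<^sub>0) \<and>
     F\<^sub>s \<in> set_pmf \<pi>\<^sub>0 \<and>
     (\<forall>F\<in>set_pmf \<pi>\<^sub>0. \<forall>a. set_pmf (F a) = UNIV) \<and>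
     (\<forall>F\<in>set_pmf \<pi>\<^sub>0. \<forall>F'\<in>set_pmf \<pi>\<^sub>0. F \<noteq> F' \<longrightarrow> (\<forall>a. F a \<noteq> F' a))"

text \<open>
  The action $a_s$, $s \ge 1$, along a path that starts in period 1, so that
  $\omega\,0 = (a_1, y_1)$.
\<close>

definition path_action :: "(nat \<Rightarrow> 'a \<times> 'y) \<Rightarrow> nat \<Rightarrow> 'a" where
  "path_action \<omega> s = fst (\<omega> (s - 1))"

text \<open>Convergence in a finite set is with respect to the discrete topology.\<close>

definition actions_converge_to :: "(nat \<Rightarrow> 'a \<times> 'y) \<Rightarrow> 'a \<Rightarrow> bool" where
  "actions_converge_to \<omega> a \<longleftrightarrow> (\<forall>\<^sub>F t in sequentially. path_action \<omega> t = a)"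

end

theory Submission
  imports Defs
begin

text \<open>
  Let $S(h)$ be the sum over the false states $F$ of the prior of the square roots of the
  subjective likelihood ratios of $F$ against $F^*$ at the history $h$. When $y$ is drawn from
  $F^*(\cdot|b)$, where $b$ is the action the agent credits for $y$, the expectation of $S$ shrinks
  by a factor $\rho < 1$, a bound on the Bhattacharyya coefficients of $F(\cdot|b)$ and
  $F^*(\cdot|b)$. Comparing an optimal strategy with the one that always plays $a^*$ shows that it
  puts probability at most $C\,S(h)$ on actions other than $a^*$.

  Once the same action $a$ has been played for $\max(k^*, k')$ periods, the agent's model agrees
  with the true process for as long as $a$ continues to be played, so $S$ decays geometrically
  in expectation on the event that the run continues. If $a \neq a^*$, the probability of the run
  is at most $C$ times that expectation and tends to $0$. If $a = a^*$, the probability lost in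
  the course of the run is bounded by a geometric series, which is small when $S$ is small
  initially. Full support makes a history with arbitrarily small $S$ followed by a long run of
  $a^*$ reachable: at each step some outcome shrinks $S$ by the factor $\rho$. Hence with positive
  probability $a^*$ is eventually played forever, which bounds its frequency from below.
\<close>

section \<open>Finite prefixes of paths\<close>

text \<open>Marginals of \<open>path_measure\<close> as distributions on lists with finite support.
  All estimates are carried out on them, as finite sums and free of measurability questions. The
  list records only the periods after \<open>h\<close>.\<close>

primrec path_prefix ::
    "('a, 'y) state \<Rightarrow> nat \<Rightarrow> ('a, 'y) strategy \<Rightarrow> ('a, 'y) history \<Rightarrow> nat \<Rightarrow> ('a \<times> 'y) list pmf" where
  "path_prefix F k \<sigma> h 0 = return_pmf []"
| "path_prefix F k \<sigma> h (Suc n) =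
     bind_pmf (path_prefix F k \<sigma> h n)
       (\<lambda>xs. map_pmf (\<lambda>x. xs @ [x]) (next_period F k \<sigma> (fst h, snd h @ xs)))"

lemma measurable_map_upt_path_measure:
  "(\<lambda>\<omega>. map \<omega> [0..<n]) \<in>
     measurable (path_measure F k \<sigma> h) (count_space (UNIV :: ('a::finite \<times> 'y::finite) list set))"
proof -
  interpret Ionescu_Tulcea "step_kernel F k \<sigma> h" "\<lambda>_. count_space UNIV"
    by (rule Ionescu_Tulcea_step_kernel)
  have "(\<lambda>\<omega>. map (restrict \<omega> {0..<n}) [0..<n]) \<in> measurable (path_measure F k \<sigma> h)
      (count_space (UNIV :: ('a \<times> 'y) list set))"
    unfolding path_measure_def measurable_cong_sets[OF PF.sets_lim refl]
    by (rule measurable_compose[OF measurable_restrict_subset measurable_map_upt]) simp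
  moreover have "map (restrict \<omega> {0..<n}) [0..<n] = map \<omega> [0..<n]" for \<omega> :: "nat \<Rightarrow> 'a \<times> 'y"
    by simp
  ultimately show ?thesis by (simp only:)
qed

text \<open>The composed kernels \<open>C 0 n\<close> of the Ionescu-Tulcea construction correspond
  to \<open>path_prefix\<close> by induction on \<open>n\<close>, one kernel \<open>eP n\<close> for
  each period. The projective limit has \<open>C 0 n\<close> as its marginal on the first
  \<open>n\<close> coordinates.\<close>

lemma distr_path_measure:
  fixes F :: "('a::finite, 'y::finite) state"
  shows "distr (path_measure F k \<sigma> h) (count_space UNIV) (\<lambda>\<omega>. map \<omega> [0..<n]) =
    measure_pmf (path_prefix F k \<sigma> h n)"
proof -
  let ?M = "\<lambda>_ :: nat. count_space (UNIV :: ('a \<times> 'y) set)"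
  \<comment> \<open>The only point of the product over the empty index set, at which
    \<open>C 0 n\<close> starts.\<close>
  let ?u = "\<lambda>_ :: nat. undefined :: 'a \<times> 'y"
  let ?m = "\<lambda>n \<omega>. map \<omega> [0..<n] :: ('a \<times> 'y) list"
  interpret Ionescu_Tulcea "step_kernel F k \<sigma> h" ?M
    by (rule Ionescu_Tulcea_step_kernel)
  have C: "distr (C 0 n ?u) (count_space UNIV) (?m n) = measure_pmf (path_prefix F k \<sigma> h n)" for n
  proof (induction n)
    case 0
    have "distr (C 0 0 ?u) (count_space UNIV) (?m 0) = return (count_space UNIV) []"
      by (simp add: distr_return space_PiM)
    then show ?case by (simp add: return_pmf.rep_eq)
  next
    case (Suc n)
    let ?N = "\<lambda>xs. measure_pmf (map_pmf (\<lambda>x. xs @ [x]) (next_period F k \<sigma> (fst h, snd h @ xs)))"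
    have u: "?u \<in> space (PiM {0..<0} ?M)" by (simp add: space_PiM)
    have sC: "sets (C 0 n ?u) = sets (PiM {0..<n} ?M)"
      using sets_C[OF u, of n] by simp
    have sp: "space (C 0 n ?u) = space (PiM {0..<n} ?M)"
      using space_C[OF u, of n] by simp
    have ne: "space (C 0 n ?u) \<noteq> {}"
      using prob_space.not_empty[OF prob_space_C[OF u]] .
    have mN: "?N \<in> measurable (count_space UNIV) (subprob_algebra (count_space UNIV))"
      by (rule measurable_count_space_eq1[THEN iffD2])
        (auto simp: space_subprob_algebra measure_pmf.subprob_space_axioms)
    \<comment> \<open>\<open>eP n\<close> is the image of the one-period kernel under updating
      coordinate \<open>n\<close>; read as lists, this update appends one entry.\<close>
    have eP: "distr (eP n \<omega>) (count_space UNIV) (?m (Suc n)) = ?N (?m n \<omega>)"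
      if "\<omega> \<in> space (C 0 n ?u)" for \<omega>
    proof -
      have \<omega>: "\<omega> \<in> space (PiM {0..<n} ?M)" using that sp by simp
      have mu: "fun_upd \<omega> n \<in> measurable (step_kernel F k \<sigma> h n \<omega>) (PiM {0..<Suc n} ?M)"
        by (rule measurable_fun_upd[where J="{0..<n}", OF _ measurable_const[OF \<omega>]]) auto
      have "distr (eP n \<omega>) (count_space UNIV) (?m (Suc n)) =
          distr (step_kernel F k \<sigma> h n \<omega>) (count_space UNIV) (?m (Suc n) \<circ> fun_upd \<omega> n)"
        unfolding eP_def by (rule distr_distr[OF measurable_map_upt mu])
      also have "?m (Suc n) \<circ> fun_upd \<omega> n = (\<lambda>x. ?m n \<omega> @ [x])"
        by (auto simp: fun_eq_iff)
      also have "distr (step_kernel F k \<sigma> h n \<omega>) (count_space UNIV) \<dots> = ?N (?m n \<omega>)"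
        by (simp add: map_pmf_rep_eq extend_history_def)
      finally show ?thesis .
    qed
    have "distr (C 0 (Suc n) ?u) (count_space UNIV) (?m (Suc n)) =
        distr (C 0 n ?u \<bind> eP n) (count_space UNIV) (?m (Suc n))" by simp
    also have "\<dots> = C 0 n ?u \<bind> (\<lambda>\<omega>. distr (eP n \<omega>) (count_space UNIV) (?m (Suc n)))"
      using measurable_eP[of n]
      by (intro distr_bind[OF _ ne measurable_map_upt]) (simp add: measurable_cong_sets[OF sC refl])
    also have "\<dots> = C 0 n ?u \<bind> (\<lambda>\<omega>. ?N (?m n \<omega>))"
      by (rule bind_cong[OF refl eP])
    also have "\<dots> = distr (C 0 n ?u) (count_space UNIV) (?m n) \<bind> ?N"
      using measurable_map_upt[of n]
      by (intro bind_distr[OF _ mN ne, symmetric]) (simp add: measurable_cong_sets[OF sC refl])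
    also have "\<dots> = measure_pmf (path_prefix F k \<sigma> h (Suc n))"
      by (simp only: Suc path_prefix.simps measure_pmf_bind)
    finally show ?case .
  qed
  \<comment> \<open>\<open>CI J\<close> restricts \<open>C 0 (up_to J)\<close> to \<open>J\<close>,
    so for an initial segment the restriction is trivial once \<open>up_to\<close> is known.\<close>
  have up: "up_to {0..<n} = n"
  proof (rule antisym)
    show "up_to {0..<n} \<le> n" by (simp add: up_to_iff)
    show "n \<le> up_to {0..<n}"
      using up_to_less[of "{0..<n}" "up_to {0..<n}"] by (cases "up_to {0..<n} < n") auto
  qed
  have CI: "CI {0..<n} = C 0 n ?u"
    using distr_C[of n n ?u 0] up by (simp add: CI_def space_PiM)
  have "distr PF.lim (count_space UNIV) (?m n) =
      distr PF.lim (count_space UNIV) (?m n \<circ> (\<lambda>\<omega>. restrict \<omega> {0..<n}))"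
    by (rule distr_cong) auto
  also have "\<dots> = distr (distr PF.lim (PiM {0..<n} ?M) (\<lambda>\<omega>. restrict \<omega> {0..<n})) (count_space UNIV) (?m n)"
    by (rule distr_distr[symmetric, OF measurable_map_upt])
      (simp add: measurable_cong_sets[OF PF.sets_lim refl] measurable_restrict_subset)
  also have "distr PF.lim (PiM {0..<n} ?M) (\<lambda>\<omega>. restrict \<omega> {0..<n}) = CI {0..<n}"
    by (rule distr_lim) simp_all
  finally show ?thesis unfolding path_measure_def CI C .
qed

lemma length_path_prefix: "xs \<in> set_pmf (path_prefix F k \<sigma> h n) \<Longrightarrow> length xs = n"
  by (induction n arbitrary: xs) auto

lemma finite_set_path_prefix:
  fixes F :: "('a::finite, 'y::finite) state"
  shows "finite (set_pmf (path_prefix F k \<sigma> h n))"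
  by (induction n) auto

lemma expectation_next_period:
  fixes F :: "('a::finite, 'y::finite) state" and f :: "'a \<times> 'y \<Rightarrow> real"
  shows "measure_pmf.expectation (next_period F k \<sigma> h) f =
    (\<Sum>a\<in>UNIV. pmf (\<sigma> h) a * (\<Sum>y\<in>UNIV. pmf (F (lagged_action k h a)) y * f (a, y)))"
  unfolding next_period_def
  by (subst pmf_expectation_bind[where A = UNIV]) (auto simp: integral_measure_pmf[where A = UNIV])

lemma expectation_path_prefix_Suc:
  fixes F :: "('a::finite, 'y::finite) state" and f :: "('a \<times> 'y) list \<Rightarrow> real"
  shows "measure_pmf.expectation (path_prefix F k \<sigma> h (Suc n)) f =
    measure_pmf.expectation (path_prefix F k \<sigma> h n)
      (\<lambda>xs. measure_pmf.expectation (next_period F k \<sigma> (fst h, snd h @ xs)) (\<lambda>x. f (xs @ [x])))"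
  by (simp add: pmf_expectation_bind[OF finite_set_path_prefix _ order_refl]
      integral_measure_pmf[OF finite_set_path_prefix])

lemma integral_path_measure:
  fixes F :: "('a::finite, 'y::finite) state" and f :: "('a \<times> 'y) list \<Rightarrow> real"
  shows "(\<integral>\<omega>. f (map \<omega> [0..<n]) \<partial>path_measure F k \<sigma> h) =
    measure_pmf.expectation (path_prefix F k \<sigma> h n) f"
  unfolding distr_path_measure[symmetric]
  by (rule integral_distr[symmetric]) (simp_all add: measurable_map_upt_path_measure)

lemma measure_path_measure:
  fixes F :: "('a::finite, 'y::finite) state"
  shows "measure (path_measure F k \<sigma> h) {\<omega> \<in> space (path_measure F k \<sigma> h). P (map \<omega> [0..<n])} =
    measure_pmf.prob (path_prefix F k \<sigma> h n) {xs. P xs}"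
  unfolding distr_path_measure[symmetric]
  by (subst measure_distr[OF measurable_map_upt_path_measure])
    (auto intro!: arg_cong2[where f = measure])

lemma pmf_next_period:
  fixes F :: "('a::finite, 'y::finite) state"
  shows "pmf (next_period F k \<sigma> h) (a, y) = pmf (\<sigma> h) a * pmf (F (lagged_action k h a)) y"
proof -
  have "pmf (next_period F k \<sigma> h) (a, y) =
      measure_pmf.expectation (next_period F k \<sigma> h) (indicator {(a, y)})"
    by (simp add: pmf.rep_eq)
  also have "\<dots> = (\<Sum>b\<in>UNIV. if b = a then pmf (\<sigma> h) a * pmf (F (lagged_action k h a)) y else 0)"
    unfolding expectation_next_period
    by (intro sum.cong) (auto simp: indicator_def of_bool_def if_distrib cong: if_cong)
  finally show ?thesis by simp
qed

lemma expectation_pmf_cong: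
  "(\<And>x. x \<in> set_pmf p \<Longrightarrow> f x = g x) \<Longrightarrow>
    measure_pmf.expectation p f = measure_pmf.expectation p (g :: _ \<Rightarrow> real)"
  by (rule integral_cong_AE) (auto simp: AE_measure_pmf_iff)

lemma expectation_pmf_mono:
  fixes f g :: "'b \<Rightarrow> real"
  assumes "finite (set_pmf p)" "\<And>x. x \<in> set_pmf p \<Longrightarrow> f x \<le> g x"
  shows "measure_pmf.expectation p f \<le> measure_pmf.expectation p g"
  using assms by (intro integral_mono_AE) (auto simp: AE_measure_pmf_iff integrable_measure_pmf_finite)

section \<open>Lagged actions and likelihoods\<close>

lemma action_at_append:
  "j \<le> int (length (snd h)) \<Longrightarrow> action_at (fst h, snd h @ xs) j = action_at h j"
  by (auto simp: action_at_def nth_append)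

lemma lagged_action_nth:
  assumes "0 < k" "k \<le> length (snd h)"
  shows "lagged_action k h a = fst (snd h ! (length (snd h) - k))"
proof -
  have "nat (1 + int (length (snd h)) - int k) - Suc 0 = length (snd h) - k" using assms by linarith
  then show ?thesis
    using assms by (simp add: lagged_action_def action_at_def current_period_def add.commute)
qed

text \<open>One step of Bayesian updating before normalisation. For \<open>k = 0\<close> the
  credited action is read off the appended pair; for positive \<open>k\<close> it already stands in
  \<open>h\<close>.\<close>

lemma likelihood_snoc:
  "likelihood k (fst h, snd h @ [(a, y)]) F =
     likelihood k h F * pmf (F (lagged_action k h a)) y"
proof -
  let ?n = "length (snd h)" and ?h = "(fst h, snd h @ [(a, y)])"
  let ?f = "\<lambda>h s. pmf (F (action_at h (int s - int k))) (snd (snd h ! (s - 1)))"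
  have "likelihood k ?h F = (\<Prod>s = 1..?n. ?f ?h s) * ?f ?h (Suc ?n)"
    by (simp add: likelihood_def)
  also have "(\<Prod>s = 1..?n. ?f ?h s) = likelihood k h F"
    unfolding likelihood_def by (intro prod.cong) (auto simp: action_at_append nth_append)
  also have "action_at ?h (int (Suc ?n) - int k) = lagged_action k h a"
  proof (cases "k = 0")
    case True
    then show ?thesis by (simp add: lagged_action_def action_at_def nat_add_distrib)
  next
    case False
    then show ?thesis
      using action_at_append[of "int (Suc ?n) - int k" h "[(a, y)]"]
      by (simp add: lagged_action_def current_period_def add.commute)
  qed
  finally show ?thesis by simp
qed

text \<open>One minus the Bhattacharyya coefficient is half the sum of the squared differences of
  the square roots, and this is positive at any point where \<open>p\<close> and \<open>q\<close>
  differ.\<close>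

lemma affinity_less_one:
  fixes p q :: "'y::finite pmf"
  assumes "p \<noteq> q"
  shows "(\<Sum>y\<in>UNIV. sqrt (pmf p y * pmf q y)) < 1"
proof -
  obtain z where z: "pmf p z \<noteq> pmf q z" using assms by (metis pmf_eqI)
  have "0 < (\<Sum>y\<in>UNIV. (sqrt (pmf p y) - sqrt (pmf q y))\<^sup>2)"
    by (rule sum_pos2[where i = z]) (use z in auto)
  also have "\<dots> = (\<Sum>y\<in>UNIV. pmf p y + pmf q y - 2 * sqrt (pmf p y * pmf q y))"
    by (intro sum.cong) (auto simp: power2_diff real_sqrt_mult)
  also have "\<dots> = 2 - 2 * (\<Sum>y\<in>UNIV. sqrt (pmf p y * pmf q y))"
    by (simp add: sum.distrib sum_subtractf sum_distrib_left sum_pmf_eq_1)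
  finally show ?thesis by simp
qed

text \<open>The first \<open>k\<close> outcomes after \<open>h\<close> are credited to actions fixed
  before the continuation starts.\<close>

lemma lagged_action_before:
  assumes "length xs < k"
  shows "lagged_action k (fst h, snd h @ xs) b =
    action_at h (int (length (snd h)) + 1 + int (length xs) - int k)"
proof -
  have "lagged_action k (fst h, snd h @ xs) b =
      action_at (fst h, snd h @ xs) (int (length (snd h)) + 1 + int (length xs) - int k)"
    using assms by (simp add: lagged_action_def current_period_def algebra_simps)
  then show ?thesis using assms by (simp add: action_at_append)
qed

text \<open>A lag of at most \<open>K\<close> cannot reach back beyond the start of the run. Used
  for the true and the subjective lag together, this makes the two laws of the next outcome
  agree.\<close>

lemma lagged_action_run:
  assumes "\<forall>i\<in>{T..<length zs}. fst (zs ! i) = a" "T + K \<le> length zs" "k \<le> K"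
  shows "lagged_action k (e, zs) a = a"
proof (cases "k = 0")
  case False
  then have "lagged_action k (e, zs) a = fst (zs ! (length zs - k))"
    using assms by (subst lagged_action_nth) auto
  moreover have "length zs - k \<in> {T..<length zs}" using assms(2,3) False by auto
  then have "fst (zs ! (length zs - k)) = a" using assms(1) by blast
  ultimately show ?thesis by simp
qed (simp add: lagged_action_def)

section \<open>Payoffs\<close>

text \<open>The outcome at index \<open>s\<close> is in the last entry of the prefix of length
  \<open>Suc s\<close>; conditioning on the first \<open>s\<close> entries turns its payoff into an
  expected payoff.\<close>

lemma expectation_period_payoff:
  fixes F :: "('a::finite, 'y::finite) state"
  shows "(\<integral>\<omega>. v (snd (\<omega> s)) \<partial>path_measure F k \<sigma> h) =
    measure_pmf.expectation (path_prefix F k \<sigma> h s) (\<lambda>xs.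
      \<Sum>a\<in>UNIV. pmf (\<sigma> (fst h, snd h @ xs)) a *
        expected_payoff v F (lagged_action k (fst h, snd h @ xs) a))"
  using integral_path_measure[where f = "\<lambda>xs. v (snd (last xs))" and n = "Suc s"
      and F = F and k = k and \<sigma> = \<sigma> and h = h]
  unfolding expectation_path_prefix_Suc expectation_next_period
  by (simp add: expected_payoff_def mult.commute)

text \<open>Later periods leave the head of the list unchanged and integrate out. With a positive
  lag the current choice pays off only after several periods, and this recovers its law at that
  time.\<close>

lemma expectation_first_action:
  fixes F :: "('a::finite, 'y::finite) state"
  shows "measure_pmf.expectation (path_prefix F k \<sigma> h (Suc n)) (\<lambda>xs. g (fst (hd xs))) =
    (\<Sum>a\<in>UNIV. pmf (\<sigma> h) a * (g a :: real))"
proof (induction n)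
  case 0
  show ?case
    unfolding expectation_path_prefix_Suc
    by (simp add: expectation_next_period sum_pmf_eq_1 flip: sum_distrib_right)
next
  case (Suc n)
  have "measure_pmf.expectation (path_prefix F k \<sigma> h (Suc (Suc n))) (\<lambda>xs. g (fst (hd xs))) =
      measure_pmf.expectation (path_prefix F k \<sigma> h (Suc n)) (\<lambda>xs. g (fst (hd xs)))"
    unfolding expectation_path_prefix_Suc[of F k \<sigma> h "Suc n"]
  proof (rule expectation_pmf_cong)
    fix xs assume "xs \<in> set_pmf (path_prefix F k \<sigma> h (Suc n))"
    then have "xs \<noteq> []" using length_path_prefix by fastforce
    then show "measure_pmf.expectation (next_period F k \<sigma> (fst h, snd h @ xs))
        (\<lambda>x. g (fst (hd (xs @ [x])))) = g (fst (hd xs))" by simp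
  qed
  with Suc show ?case by simp
qed

text \<open>Everything is dominated by the geometric series with terms
  \<open>\<delta> ^ s * B\<close>, which also justifies exchanging sum and integral.\<close>

lemma
  fixes F :: "('a::finite, 'y::finite) state" and v :: "'y \<Rightarrow> real"
  assumes \<delta>: "0 \<le> \<delta>" "\<delta> < 1" and B: "\<And>y. \<bar>v y\<bar> \<le> B"
  shows summable_discounted_payoff:
      "summable (\<lambda>s. \<delta> ^ s * (\<integral>\<omega>. v (snd (\<omega> s)) \<partial>path_measure F k \<sigma> h))"
    and integral_discounted_payoff:
      "(\<integral>\<omega>. (\<Sum>s. \<delta> ^ s * v (snd (\<omega> s))) \<partial>path_measure F k \<sigma> h) =
        (\<Sum>s. \<delta> ^ s * (\<integral>\<omega>. v (snd (\<omega> s)) \<partial>path_measure F k \<sigma> h))"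
    and abs_discounted_payoff_le:
      "\<bar>\<integral>\<omega>. (\<Sum>s. \<delta> ^ s * v (snd (\<omega> s))) \<partial>path_measure F k \<sigma> h\<bar> \<le> B / (1 - \<delta>)"
proof -
  let ?P = "path_measure F k \<sigma> h"
  interpret P: prob_space ?P by (rule prob_space_path_measure)
  have "(\<lambda>\<omega>. v (snd (last (map \<omega> [0..<Suc s])))) \<in> borel_measurable ?P" for s
    by (rule measurable_compose[OF measurable_map_upt_path_measure]) simp
  then have meas: "(\<lambda>\<omega>. v (snd (\<omega> s))) \<in> borel_measurable ?P" for s by simp
  have int: "integrable ?P (\<lambda>\<omega>. v (snd (\<omega> s)))" for s
    by (rule P.integrable_const_bound[where B = B]) (use B meas in auto)
  have B0: "0 \<le> B" using B[of undefined] by simp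
  have le: "\<bar>\<integral>\<omega>. v (snd (\<omega> s)) \<partial>?P\<bar> \<le> B" for s
  proof -
    have "\<bar>\<integral>\<omega>. v (snd (\<omega> s)) \<partial>?P\<bar> \<le> (\<integral>\<omega>. \<bar>v (snd (\<omega> s))\<bar> \<partial>?P)"
      by (rule integral_abs_bound)
    also have "\<dots> \<le> (\<integral>\<omega>. B \<partial>?P)"
      by (intro integral_mono) (use int B in auto)
    finally show ?thesis by (simp add: P.prob_space)
  qed
  have geo: "(\<lambda>s. \<delta> ^ s * B) sums (B / (1 - \<delta>))"
    using sums_mult2[OF geometric_sums[of \<delta>], of B] \<delta> by simp
  have le\<delta>: "norm (\<delta> ^ s * (\<integral>\<omega>. v (snd (\<omega> s)) \<partial>?P)) \<le> \<delta> ^ s * B" for s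
    using le[of s] \<delta> by (simp add: abs_mult mult_left_mono)
  show "summable (\<lambda>s. \<delta> ^ s * (\<integral>\<omega>. v (snd (\<omega> s)) \<partial>?P))"
    by (rule summable_comparison_test'[OF sums_summable[OF geo]]) (rule le\<delta>)
  have ptw: "norm (\<delta> ^ s * v (snd (\<omega> s))) \<le> \<delta> ^ s * B" for s \<omega>
    using B \<delta> by (simp add: abs_mult mult_left_mono)
  show eq: "(\<integral>\<omega>. (\<Sum>s. \<delta> ^ s * v (snd (\<omega> s))) \<partial>?P) =
      (\<Sum>s. \<delta> ^ s * (\<integral>\<omega>. v (snd (\<omega> s)) \<partial>?P))"
  proof (subst integral_suminf)
    show "AE \<omega> in ?P. summable (\<lambda>s. norm (\<delta> ^ s * v (snd (\<omega> s))))"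
      by (intro AE_I2 summable_comparison_test'[OF sums_summable[OF geo]]) (use ptw in auto)
    have "(\<integral>\<omega>. norm (\<delta> ^ s * v (snd (\<omega> s))) \<partial>?P) \<le> (\<integral>\<omega>. \<delta> ^ s * B \<partial>?P)" for s
      by (intro integral_mono integrable_norm integrable_mult_right int ptw) simp
    then show "summable (\<lambda>s. \<integral>\<omega>. norm (\<delta> ^ s * v (snd (\<omega> s))) \<partial>?P)"
      by (intro summable_comparison_test'[OF sums_summable[OF geo]]) (simp add: P.prob_space)
  qed (auto intro: int)
  show "\<bar>\<integral>\<omega>. (\<Sum>s. \<delta> ^ s * v (snd (\<omega> s))) \<partial>?P\<bar> \<le> B / (1 - \<delta>)"
    unfolding eq sums_unique[OF geo] real_norm_def[symmetric]
    by (rule norm_suminf_le[OF le\<delta> sums_summable[OF geo]])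
qed

lemma constant_path_prefix:
  "xs \<in> set_pmf (path_prefix F k (\<lambda>_. return_pmf a) h n) \<Longrightarrow> x \<in> set xs \<Longrightarrow> fst x = a"
  by (induction n arbitrary: xs) (auto simp: next_period_def)

lemma expected_payoff_gap:
  fixes F :: "('a::finite, 'y::finite) state"
  assumes "\<forall>a. is_arg_max (expected_payoff v F) (\<lambda>_. True) a \<longleftrightarrow> a = a\<^sub>s"
  obtains g where "0 < g" "\<And>a. a \<noteq> a\<^sub>s \<Longrightarrow> expected_payoff v F a \<le> expected_payoff v F a\<^sub>s - g"
proof -
  let ?u = "expected_payoff v F"
  have le: "?u a \<le> ?u a\<^sub>s" for a
    using assms by (auto simp: is_arg_max_def not_less)
  have lt: "?u a < ?u a\<^sub>s" if "a \<noteq> a\<^sub>s" for a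
  proof (rule ccontr)
    assume "\<not> ?u a < ?u a\<^sub>s"
    then have "?u b \<le> ?u a" for b using le[of b] by simp
    then have "is_arg_max ?u (\<lambda>_. True) a" by (auto simp: is_arg_max_def not_less)
    with assms that show False by blast
  qed
  \<comment> \<open>The element \<open>1\<close> keeps the minimum defined when
    \<open>a\<^sub>s\<close> is the only action.\<close>
  define A where "A = insert 1 ((\<lambda>a. ?u a\<^sub>s - ?u a) ` (UNIV - {a\<^sub>s}))"
  have "finite A" "A \<noteq> {}" "\<forall>x\<in>A. 0 < x" using lt by (auto simp: A_def)
  then have "0 < Min A" by (metis Min_in)
  moreover have "?u a \<le> ?u a\<^sub>s - Min A" if "a \<noteq> a\<^sub>s" for a
  proof -
    have "?u a\<^sub>s - ?u a \<in> A" using that by (auto simp: A_def)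
    from Min_le[OF \<open>finite A\<close> this] show ?thesis by simp
  qed
  ultimately show ?thesis using that by blast
qed

text \<open>At indices \<open>s < k\<close> both payoffs are determined by \<open>h\<close>. From
  \<open>k\<close> on the constant strategy earns the maximum in every period. At
  \<open>s = k\<close> the credited action is exactly the one chosen at \<open>h\<close>, so each
  wrong choice costs at least \<open>g\<close> there.\<close>

lemma period_payoff_gain:
  fixes F :: "('a::finite, 'y::finite) state"
  assumes g: "0 < g" "\<And>a. a \<noteq> a\<^sub>s \<Longrightarrow> expected_payoff v F a \<le> expected_payoff v F a\<^sub>s - g"
  shows "(\<integral>\<omega>. v (snd (\<omega> s)) \<partial>path_measure F k \<sigma> h) +
      (if s = k then g * (1 - pmf (\<sigma> h) a\<^sub>s) else 0)
    \<le> (\<integral>\<omega>. v (snd (\<omega> s)) \<partial>path_measure F k (\<lambda>_. return_pmf a\<^sub>s) h)"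
proof -
  let ?u = "expected_payoff v F" and ?c = "\<lambda>_. return_pmf a\<^sub>s"
  let ?m = "\<lambda>\<sigma>. \<integral>\<omega>. v (snd (\<omega> s)) \<partial>path_measure F k \<sigma> h"
  have u: "?u a \<le> ?u a\<^sub>s" for a using g(1) g(2)[of a] by (cases "a = a\<^sub>s") auto
  show ?thesis
  proof (cases "s < k")
    case True
    have "?m \<sigma> = ?u (action_at h (int (length (snd h)) + 1 + int s - int k))" for \<sigma>
    proof -
      have "?m \<sigma> = measure_pmf.expectation (path_prefix F k \<sigma> h s)
          (\<lambda>_. ?u (action_at h (int (length (snd h)) + 1 + int s - int k)))"
        unfolding expectation_period_payoff
        using True by (intro expectation_pmf_cong)
          (auto simp: lagged_action_before sum_pmf_eq_1 dest!: length_path_prefix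
            simp flip: sum_distrib_right)
      then show ?thesis by simp
    qed
    with True show ?thesis by simp
  next
    case False
    have "?m ?c = measure_pmf.expectation (path_prefix F k ?c h s) (\<lambda>_. ?u a\<^sub>s)"
      unfolding expectation_period_payoff
    proof (rule expectation_pmf_cong)
      fix xs assume xs: "xs \<in> set_pmf (path_prefix F k ?c h s)"
      have "lagged_action k (fst h, snd h @ xs) a\<^sub>s = a\<^sub>s"
      proof (cases "k = 0")
        case False
        have len: "length xs = s" by (rule length_path_prefix[OF xs])
        with \<open>\<not> s < k\<close> False have "xs ! (s - k) \<in> set xs" by auto
        with constant_path_prefix[OF xs] have "fst (xs ! (s - k)) = a\<^sub>s" by blast
        with len False \<open>\<not> s < k\<close> show ?thesis
          by (subst lagged_action_nth) (auto simp: nth_append)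
      qed (simp add: lagged_action_def)
      then show "(\<Sum>a\<in>UNIV. pmf (?c (fst h, snd h @ xs)) a *
          ?u (lagged_action k (fst h, snd h @ xs) a)) = ?u a\<^sub>s"
        by (subst sum.remove[of _ a\<^sub>s]) auto
    qed
    then have c: "?m ?c = ?u a\<^sub>s" by simp
    have "(\<Sum>a\<in>UNIV. pmf (\<sigma> h') a * ?u (f a)) \<le> (\<Sum>a\<in>UNIV. pmf (\<sigma> h') a * ?u a\<^sub>s)" for h' f
      by (intro sum_mono mult_left_mono u) auto
    then have avg: "(\<Sum>a\<in>UNIV. pmf (\<sigma> h') a * ?u (f a)) \<le> ?u a\<^sub>s" for h' f
      by (simp add: sum_pmf_eq_1 flip: sum_distrib_right)
    show ?thesis
    proof (cases "s = k")
      case True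
      have "?m \<sigma> = (\<Sum>a\<in>UNIV. pmf (\<sigma> h) a * ?u a)"
      proof (cases k)
        case 0
        then show ?thesis
          using True by (simp add: expectation_period_payoff lagged_action_def)
      next
        case (Suc n)
        have "?m \<sigma> = measure_pmf.expectation (path_prefix F k \<sigma> h (Suc n)) (\<lambda>xs. ?u (fst (hd xs)))"
          unfolding expectation_period_payoff True Suc
        proof (rule expectation_pmf_cong)
          fix xs assume "xs \<in> set_pmf (path_prefix F (Suc n) \<sigma> h (Suc n))"
          then have len: "length xs = Suc n" by (rule length_path_prefix)
          then have "xs \<noteq> []" by auto
          with len have "lagged_action (Suc n) (fst h, snd h @ xs) a = fst (hd xs)" for a
            by (subst lagged_action_nth) (auto simp: nth_append hd_conv_nth)
          then show "(\<Sum>a\<in>UNIV. pmf (\<sigma> (fst h, snd h @ xs)) a *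
              ?u (lagged_action (Suc n) (fst h, snd h @ xs) a)) = ?u (fst (hd xs))"
            by (simp add: sum_pmf_eq_1 flip: sum_distrib_right)
        qed
        then show ?thesis by (simp only: expectation_first_action)
      qed
      also have "\<dots> \<le> (\<Sum>a\<in>UNIV. pmf (\<sigma> h) a * (?u a\<^sub>s - g * (1 - of_bool (a = a\<^sub>s))))"
        by (intro sum_mono mult_left_mono) (use g(2) in auto)
      also have "\<dots> = (\<Sum>a\<in>UNIV. pmf (\<sigma> h) a * (?u a\<^sub>s - g) +
          (if a = a\<^sub>s then pmf (\<sigma> h) a\<^sub>s * g else 0))"
        by (intro sum.cong) (auto simp: algebra_simps)
      also have "\<dots> = (?u a\<^sub>s - g) + pmf (\<sigma> h) a\<^sub>s * g"
        by (simp add: sum.distrib sum_pmf_eq_1 flip: sum_distrib_right)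
      also have "\<dots> = ?u a\<^sub>s - g * (1 - pmf (\<sigma> h) a\<^sub>s)" by (simp add: algebra_simps)
      finally show ?thesis using c True by simp
    next
      case False
      have "?m \<sigma> \<le> measure_pmf.expectation (path_prefix F k \<sigma> h s) (\<lambda>_. ?u a\<^sub>s)"
        unfolding expectation_period_payoff by (intro expectation_pmf_mono finite_set_path_prefix avg)
      with c False show ?thesis by simp
    qed
  qed
qed

section \<open>Learning under a regular prior\<close>

locale regular_learning =
  fixes F_star :: "('a::finite, 'y::finite) state" and \<pi>\<^sub>0 :: "('a, 'y) state pmf"
  assumes regular: "regular_prior F_star \<pi>\<^sub>0"
begin

lemma finite_prior: "finite (set_pmf \<pi>\<^sub>0)"
  and F_star_in_prior: "F_star \<in> set_pmf \<pi>\<^sub>0"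
  and full_support: "F \<in> set_pmf \<pi>\<^sub>0 \<Longrightarrow> 0 < pmf (F a) y"
  and distinguishable: "F \<in> set_pmf \<pi>\<^sub>0 \<Longrightarrow> F \<noteq> F_star \<Longrightarrow> F a \<noteq> F_star a"
  using regular unfolding regular_prior_def
  by (auto simp: pmf_positive_iff)

section \<open>Square-root odds: contraction and control of optimal choices\<close>

lemma likelihood_pos: "F \<in> set_pmf \<pi>\<^sub>0 \<Longrightarrow> 0 < likelihood k h F"
  unfolding likelihood_def by (intro prod_pos) (auto simp: full_support)

text \<open>Under \<open>F_star\<close> the plain likelihood ratio has constant mean; its square
  root has a strictly decreasing one. Prior weights are left to the constant in
  \<open>optimal_choice_bound\<close>.\<close>

definition sqrt_odds :: "nat \<Rightarrow> ('a, 'y) history \<Rightarrow> real" where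
  "sqrt_odds k h =
     (\<Sum>F\<in>set_pmf \<pi>\<^sub>0 - {F_star}. sqrt (likelihood k h F / likelihood k h F_star))"

lemma sqrt_odds_nonneg: "0 \<le> sqrt_odds k h"
  unfolding sqrt_odds_def
  by (intro sum_nonneg) (auto intro!: divide_nonneg_nonneg simp: less_imp_le likelihood_pos F_star_in_prior)

text \<open>Weighting the updated square-root ratio by the true probability of \<open>y\<close>
  gives the old one times \<open>sqrt (pmf (F b) y * pmf (F_star b) y)\<close>, so summing over
  \<open>y\<close> produces a Bhattacharyya coefficient. Only finitely many coefficients occur,
  hence one \<open>\<rho>\<close> serves all lags and histories.\<close>

lemma sqrt_odds_contraction:
  obtains \<rho> where "0 \<le> \<rho>" "\<rho> < 1"
    "\<And>k h a. (\<Sum>y\<in>UNIV. pmf (F_star (lagged_action k h a)) y *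
        sqrt_odds k (fst h, snd h @ [(a, y)])) \<le> \<rho> * sqrt_odds k h"
proof -
  \<comment> \<open>The element \<open>0\<close> covers a prior concentrated on
    \<open>F_star\<close> and makes the maximum nonnegative.\<close>
  define A where "A = insert 0 ((\<lambda>(F, b). \<Sum>y\<in>UNIV. sqrt (pmf (F b) y * pmf (F_star b) y)) `
    ((set_pmf \<pi>\<^sub>0 - {F_star}) \<times> UNIV))"
  have fin: "finite A" unfolding A_def using finite_prior by auto
  have le: "(\<Sum>y\<in>UNIV. sqrt (pmf (F b) y * pmf (F_star b) y)) \<le> Max A"
    if "F \<in> set_pmf \<pi>\<^sub>0 - {F_star}" for F b
    by (rule Max_ge[OF fin]) (use that in \<open>auto simp: A_def\<close>)
  have A0: "0 \<in> A" by (simp add: A_def)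
  have "x < 1" if "x \<in> A" for x
    using that unfolding A_def by (auto intro!: affinity_less_one dest: distinguishable)
  then have "Max A < 1" using Max_in[OF fin] A0 by blast
  moreover have "0 \<le> Max A" using Max_ge[OF fin A0] .
  moreover have "(\<Sum>y\<in>UNIV. pmf (F_star (lagged_action k h a)) y *
        sqrt_odds k (fst h, snd h @ [(a, y)])) \<le> Max A * sqrt_odds k h" for k h a
  proof -
    let ?b = "lagged_action k h a" and ?S = "set_pmf \<pi>\<^sub>0 - {F_star}"
    let ?r = "\<lambda>F. sqrt (likelihood k h F / likelihood k h F_star)"
    have "pmf (F_star ?b) y * sqrt (x * pmf (F ?b) y / (z * pmf (F_star ?b) y)) =
        sqrt (x / z) * sqrt (pmf (F ?b) y * pmf (F_star ?b) y)" for x y z F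
    proof -
      define q where "q = sqrt (pmf (F_star ?b) y)"
      have "0 < q" and q: "pmf (F_star ?b) y = q * q"
        using full_support[OF F_star_in_prior, of ?b y] by (auto simp: q_def)
      then show ?thesis unfolding real_sqrt_mult real_sqrt_divide q by simp
    qed
    then have "(\<Sum>y\<in>UNIV. pmf (F_star ?b) y * sqrt_odds k (fst h, snd h @ [(a, y)])) =
        (\<Sum>y\<in>UNIV. \<Sum>F\<in>?S. ?r F * sqrt (pmf (F ?b) y * pmf (F_star ?b) y))"
      unfolding sqrt_odds_def likelihood_snoc by (simp add: sum_distrib_left)
    also have "\<dots> = (\<Sum>F\<in>?S. ?r F * (\<Sum>y\<in>UNIV. sqrt (pmf (F ?b) y * pmf (F_star ?b) y)))"
      by (subst sum.swap) (simp add: sum_distrib_left)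
    also have "\<dots> \<le> (\<Sum>F\<in>?S. ?r F * Max A)"
      by (intro sum_mono mult_left_mono le)
        (auto intro!: divide_nonneg_nonneg simp: less_imp_le likelihood_pos F_star_in_prior)
    also have "\<dots> = Max A * sqrt_odds k h"
      by (simp add: sqrt_odds_def sum_distrib_left mult.commute)
    finally show ?thesis .
  qed
  ultimately show ?thesis using that by blast
qed

text \<open>Switching to the constant strategy gains at least \<open>\<delta> ^ k * g\<close> times
  the probability of a wrong choice if \<open>F_star\<close> is true, and loses at most
  \<open>M\<close> in any other state. Optimality weighs the two by the posterior, so the
  probability of a wrong choice is at most \<open>K\<close> times the sum of the likelihood ratios;
  square roots then lead to \<open>sqrt_odds\<close>.\<close>

lemma optimal_choice_bound:
  assumes opt: "\<sigma> \<in> optimal_strategies \<delta> v k \<pi>\<^sub>0"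
    and max: "\<forall>a. is_arg_max (expected_payoff v F_star) (\<lambda>_. True) a \<longleftrightarrow> a = a\<^sub>s"
    and \<delta>: "(0 < \<delta> \<and> \<delta> < 1) \<or> (\<delta> = 0 \<and> k = 0)"
  obtains C where "0 \<le> C" "\<And>h. 1 - pmf (\<sigma> h) a\<^sub>s \<le> C * sqrt_odds k h"
proof -
  \<comment> \<open>The power is positive also for \<open>\<delta> = 0\<close>, because then
    \<open>k = 0\<close> and \<open>0 ^ 0 = 1\<close>.\<close>
  have \<delta>': "0 \<le> \<delta>" "\<delta> < 1" "0 < \<delta> ^ k" using \<delta> by auto
  obtain g where g: "0 < g"
      "\<And>a. a \<noteq> a\<^sub>s \<Longrightarrow> expected_payoff v F_star a \<le> expected_payoff v F_star a\<^sub>s - g"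
    using expected_payoff_gap[OF max] by blast
  define B where "B = (\<Sum>y\<in>UNIV. \<bar>v y\<bar>)"
  have B: "\<bar>v y\<bar> \<le> B" for y unfolding B_def by (rule member_le_sum) auto
  \<comment> \<open>Each discounted value is at most \<open>B / (1 - \<delta>)\<close> in absolute
    value, so two of them differ by at most \<open>M\<close>.\<close>
  define M where "M = 2 * (B / (1 - \<delta>))"
  define K where "K = M / (pmf \<pi>\<^sub>0 F_star * (\<delta> ^ k * g))"
  let ?c = "\<lambda>_. return_pmf a\<^sub>s" and ?S = "set_pmf \<pi>\<^sub>0 - {F_star}"
  have \<pi>pos: "0 < pmf \<pi>\<^sub>0 F_star" using F_star_in_prior by (simp add: pmf_positive_iff)
  have "0 \<le> B" using B[of undefined] by simp
  then have "0 \<le> M" using \<delta>' by (simp add: M_def)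
  then have "0 \<le> K" using \<delta>' g \<pi>pos by (simp add: K_def)
  show ?thesis
  proof (rule that[of "sqrt K"])
    fix h
    let ?L = "likelihood k h" and ?q = "1 - pmf (\<sigma> h) a\<^sub>s"
    let ?W = "\<lambda>\<sigma> F. \<integral>\<omega>. (\<Sum>s. \<delta> ^ s * v (snd (\<omega> s))) \<partial>path_measure F k \<sigma> h"
    let ?m = "\<lambda>\<sigma> s. \<integral>\<omega>. v (snd (\<omega> s)) \<partial>path_measure F_star k \<sigma> h"
    have gain: "\<delta> ^ k * (g * ?q) \<le> ?W ?c F_star - ?W \<sigma> F_star"
    proof -
      have gain_s: "(if s = k then g * ?q else 0) \<le> ?m ?c s - ?m \<sigma> s" for s
        using period_payoff_gain[OF g, where s = s and k = k and \<sigma> = \<sigma> and h = h] by linarith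
      have nonneg: "0 \<le> ?m ?c s - ?m \<sigma> s" for s
      proof -
        have "0 \<le> (if s = k then g * ?q else 0)" using g(1) by (simp add: pmf_le_1)
        then show ?thesis using gain_s by (rule order_trans)
      qed
      have sm: "summable (\<lambda>s. \<delta> ^ s * ?m \<sigma> s)" for \<sigma>
        by (rule summable_discounted_payoff[where v = v, OF \<delta>'(1,2) B])
      have W: "?W \<sigma> F_star = (\<Sum>s. \<delta> ^ s * ?m \<sigma> s)" for \<sigma>
        by (rule integral_discounted_payoff[where v = v, OF \<delta>'(1,2) B])
      have "?W ?c F_star - ?W \<sigma> F_star = (\<Sum>s. \<delta> ^ s * ?m ?c s) - (\<Sum>s. \<delta> ^ s * ?m \<sigma> s)"
        by (simp only: W)
      also have "\<dots> = (\<Sum>s. \<delta> ^ s * (?m ?c s - ?m \<sigma> s))"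
        by (simp only: suminf_diff[OF sm sm] right_diff_distrib)
      finally have "?W ?c F_star - ?W \<sigma> F_star = (\<Sum>s. \<delta> ^ s * (?m ?c s - ?m \<sigma> s))" .
      \<comment> \<open>All terms are nonnegative, so the series dominates its term at
        \<open>k\<close>, the one where the current choice pays off.\<close>
      moreover have "(\<Sum>s\<in>{k}. \<delta> ^ s * (?m ?c s - ?m \<sigma> s)) \<le> (\<Sum>s. \<delta> ^ s * (?m ?c s - ?m \<sigma> s))"
      proof (rule sum_le_suminf)
        show "summable (\<lambda>s. \<delta> ^ s * (?m ?c s - ?m \<sigma> s))"
          using summable_diff[OF sm sm] by (simp add: right_diff_distrib)
      qed (use \<delta>' nonneg in auto)
      moreover have "\<delta> ^ k * (g * ?q) \<le> \<delta> ^ k * (?m ?c k - ?m \<sigma> k)"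
        using gain_s[of k] \<delta>' by (intro mult_left_mono) auto
      ultimately show ?thesis by simp
    qed
    have loss: "?W \<sigma> F - ?W ?c F \<le> M" for F
      using abs_discounted_payoff_le[where v = v, OF \<delta>'(1,2) B, of F k \<sigma> h]
        abs_discounted_payoff_le[where v = v, OF \<delta>'(1,2) B, of F k ?c h]
      unfolding M_def by linarith
    \<comment> \<open>The denominator in Bayes' rule is common to both strategies and
      cancels.\<close>
    define Z where "Z = (\<Sum>G\<in>set_pmf \<pi>\<^sub>0. pmf \<pi>\<^sub>0 G * ?L G)"
    have "0 < Z" unfolding Z_def using F_star_in_prior finite_prior
      by (intro sum_pos) (auto simp: likelihood_pos pmf_positive_iff)
    have V: "subjective_value \<delta> v k \<pi>\<^sub>0 \<sigma> h = (\<Sum>F\<in>set_pmf \<pi>\<^sub>0. pmf \<pi>\<^sub>0 F * ?L F * ?W \<sigma> F) / Z" for \<sigma>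
      by (simp add: subjective_value_def posterior_def Z_def[symmetric] sum_divide_distrib)
    have "subjective_value \<delta> v k \<pi>\<^sub>0 ?c h \<le> subjective_value \<delta> v k \<pi>\<^sub>0 \<sigma> h"
      using opt unfolding optimal_strategies_def by blast
    then have "(\<Sum>F\<in>set_pmf \<pi>\<^sub>0. pmf \<pi>\<^sub>0 F * ?L F * (?W ?c F - ?W \<sigma> F)) \<le> 0"
      using \<open>0 < Z\<close> unfolding V by (simp add: divide_le_cancel right_diff_distrib sum_subtractf)
    also have "(\<Sum>F\<in>set_pmf \<pi>\<^sub>0. pmf \<pi>\<^sub>0 F * ?L F * (?W ?c F - ?W \<sigma> F)) =
        pmf \<pi>\<^sub>0 F_star * ?L F_star * (?W ?c F_star - ?W \<sigma> F_star) -
        (\<Sum>F\<in>?S. pmf \<pi>\<^sub>0 F * ?L F * (?W \<sigma> F - ?W ?c F))"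
      by (subst sum.remove[OF finite_prior F_star_in_prior])
        (simp add: right_diff_distrib sum_subtractf)
    finally have "pmf \<pi>\<^sub>0 F_star * ?L F_star * (?W ?c F_star - ?W \<sigma> F_star) \<le>
        (\<Sum>F\<in>?S. pmf \<pi>\<^sub>0 F * ?L F * (?W \<sigma> F - ?W ?c F))" by simp
    moreover have "pmf \<pi>\<^sub>0 F_star * ?L F_star * (\<delta> ^ k * (g * ?q)) \<le>
        pmf \<pi>\<^sub>0 F_star * ?L F_star * (?W ?c F_star - ?W \<sigma> F_star)"
      using likelihood_pos[OF F_star_in_prior, of k h] \<pi>pos
      by (intro mult_left_mono gain) auto
    moreover have "(\<Sum>F\<in>?S. pmf \<pi>\<^sub>0 F * ?L F * (?W \<sigma> F - ?W ?c F)) \<le> (\<Sum>F\<in>?S. 1 * ?L F * M)"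
    proof (rule sum_mono)
      fix F assume "F \<in> ?S"
      then have L: "0 < ?L F" using likelihood_pos by simp
      then have "pmf \<pi>\<^sub>0 F * ?L F * (?W \<sigma> F - ?W ?c F) \<le> pmf \<pi>\<^sub>0 F * ?L F * M"
        by (intro mult_left_mono loss) auto
      also have "\<dots> \<le> 1 * ?L F * M"
        using L \<open>0 \<le> M\<close> by (intro mult_right_mono) (auto simp: pmf_le_1)
      finally show "pmf \<pi>\<^sub>0 F * ?L F * (?W \<sigma> F - ?W ?c F) \<le> 1 * ?L F * M" .
    qed
    ultimately have "?q * (pmf \<pi>\<^sub>0 F_star * (\<delta> ^ k * g) * ?L F_star) \<le> M * (\<Sum>F\<in>?S. ?L F)"
      by (simp add: sum_distrib_left algebra_simps)
    moreover have pos: "0 < pmf \<pi>\<^sub>0 F_star * (\<delta> ^ k * g) * ?L F_star"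
      using likelihood_pos[OF F_star_in_prior, of k h] \<pi>pos g \<delta>' by simp
    ultimately have "?q \<le> M * (\<Sum>F\<in>?S. ?L F) / (pmf \<pi>\<^sub>0 F_star * (\<delta> ^ k * g) * ?L F_star)"
      by (simp only: pos_le_divide_eq)
    also have "\<dots> = K * (\<Sum>F\<in>?S. ?L F / ?L F_star)"
      by (simp add: K_def flip: sum_divide_distrib)
    finally have q: "?q \<le> K * (\<Sum>F\<in>?S. ?L F / ?L F_star)" .
    \<comment> \<open>A number in the unit interval is at most its square root, which allows the
      passage to square roots.\<close>
    have "?q * ?q \<le> ?q * 1"
      by (intro mult_left_mono) (auto simp: pmf_le_1)
    then have "?q \<le> sqrt ?q"
      by (intro real_le_rsqrt) (simp add: power2_eq_square)
    also have "\<dots> \<le> sqrt K * sqrt (\<Sum>F\<in>?S. ?L F / ?L F_star)"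
      using q by (simp flip: real_sqrt_mult)
    \<comment> \<open>The root of the sum is the Euclidean norm of the vector of square roots, and
      \<open>sqrt_odds\<close> is the larger 1-norm.\<close>
    also have "sqrt (\<Sum>F\<in>?S. ?L F / ?L F_star) = L2_set (\<lambda>F. sqrt (?L F / ?L F_star)) ?S"
      unfolding L2_set_def
      by (intro arg_cong[where f = sqrt] sum.cong)
        (auto simp: less_imp_le likelihood_pos F_star_in_prior)
    also have "sqrt K * \<dots> \<le> sqrt K * sqrt_odds k h"
      unfolding sqrt_odds_def using \<open>0 \<le> K\<close>
      by (intro mult_left_mono L2_set_le_sum)
        (auto intro!: divide_nonneg_nonneg simp: less_imp_le likelihood_pos F_star_in_prior)
    finally show "?q \<le> sqrt K * sqrt_odds k h" .
  qed (use \<open>0 \<le> K\<close> in simp)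
qed

section \<open>Reaching small odds with positive probability\<close>

lemma exists_contracting_outcome:
  assumes "\<And>h a. (\<Sum>y\<in>UNIV. pmf (F_star (lagged_action k h a)) y *
      sqrt_odds k (fst h, snd h @ [(a, y)])) \<le> \<rho> * sqrt_odds k h"
  shows "\<exists>y. sqrt_odds k (fst h, snd h @ [(a, y)]) \<le> \<rho> * sqrt_odds k h"
proof (rule ccontr)
  let ?p = "pmf (F_star (lagged_action k h a))"
  assume "\<not> ?thesis"
  then have "\<rho> * sqrt_odds k h < sqrt_odds k (fst h, snd h @ [(a, y)])" for y
    by (simp add: not_le)
  \<comment> \<open>All weights are positive by full support, so values that all exceed the bound
    would have a mean above it.\<close>
  then have "(\<Sum>y\<in>UNIV. ?p y * (\<rho> * sqrt_odds k h)) <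
      (\<Sum>y\<in>UNIV. ?p y * sqrt_odds k (fst h, snd h @ [(a, y)]))"
    by (intro sum_strict_mono mult_strict_left_mono full_support F_star_in_prior) auto
  with assms[of h a] show False by (simp add: sum_pmf_eq_1 flip: sum_distrib_right)
qed

text \<open>Full support leaves the outcome free, whatever action the true lag credits; only the
  action must be one that the strategy may play.\<close>

lemma path_prefix_snoc:
  assumes "xs \<in> set_pmf (path_prefix F_star k\<^sub>s \<sigma> h n)"
    and "a \<in> set_pmf (\<sigma> (fst h, snd h @ xs))"
  shows "xs @ [(a, y)] \<in> set_pmf (path_prefix F_star k\<^sub>s \<sigma> h (Suc n))"
proof -
  have "(a, y) \<in> set_pmf (next_period F_star k\<^sub>s \<sigma> (fst h, snd h @ xs))"
    using assms(2) full_support[OF F_star_in_prior]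
    by (simp add: pmf_next_period set_pmf_iff less_imp_neq[symmetric])
  with assms(1) show ?thesis by auto
qed

text \<open>For \<open>n\<close> periods any action in the support of the strategy is followed by a
  contracting outcome, until the odds are small. Then \<open>a\<^sub>s\<close> itself has positive
  probability, and contracting outcomes keep the odds small while it is played \<open>K\<close>
  times.\<close>

lemma exists_learning_prefix:
  assumes \<rho>: "0 \<le> \<rho>" "\<rho> < 1"
    and contr: "\<And>h a. (\<Sum>y\<in>UNIV. pmf (F_star (lagged_action k h a)) y *
      sqrt_odds k (fst h, snd h @ [(a, y)])) \<le> \<rho> * sqrt_odds k h"
    and C: "0 \<le> C" "\<And>h. 1 - pmf (\<sigma> h) a\<^sub>s \<le> C * sqrt_odds k h"
    and "0 < \<epsilon>"
  obtains n xs where "xs \<in> set_pmf (path_prefix F_star k\<^sub>s \<sigma> (e, []) (n + K))"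
    "\<forall>i\<in>{n..<n + K}. fst (xs ! i) = a\<^sub>s" "sqrt_odds k (e, xs) < \<epsilon>"
proof -
  let ?P = "path_prefix F_star k\<^sub>s \<sigma> (e, [])" and ?S = "\<lambda>xs. sqrt_odds k (e, xs)"
  have step: "\<exists>y. ?S (xs @ [(a, y)]) \<le> \<rho> * ?S xs" for xs a
    using exists_contracting_outcome[OF contr, of "(e, xs)" a] by simp
  \<comment> \<open>With odds below \<open>\<epsilon>'\<close> the bound on wrong choices is below
    1, so \<open>a\<^sub>s\<close> is in the support. The summand 1 avoids division by zero.\<close>
  define \<epsilon>' where "\<epsilon>' = min \<epsilon> (1 / (C + 1))"
  have \<epsilon>': "0 < \<epsilon>'" "\<epsilon>' \<le> \<epsilon>" "C * \<epsilon>' < 1"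
  proof -
    show "0 < \<epsilon>'" "\<epsilon>' \<le> \<epsilon>" using \<open>0 < \<epsilon>\<close> C(1) by (auto simp: \<epsilon>'_def)
    have "C * \<epsilon>' \<le> C * (1 / (C + 1))" using C(1) by (intro mult_left_mono) (auto simp: \<epsilon>'_def)
    also have "\<dots> < 1" using C(1) by (simp add: field_simps)
    finally show "C * \<epsilon>' < 1" .
  qed
  have shrink: "\<exists>xs\<in>set_pmf (?P n). ?S xs \<le> \<rho> ^ n * ?S []" for n
  proof (induction n)
    case (Suc n)
    then obtain xs where xs: "xs \<in> set_pmf (?P n)" "?S xs \<le> \<rho> ^ n * ?S []" by blast
    obtain a where a: "a \<in> set_pmf (\<sigma> (e, xs))" using set_pmf_not_empty by fast
    obtain y where "?S (xs @ [(a, y)]) \<le> \<rho> * ?S xs" using step by blast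
    also have "\<dots> \<le> \<rho> ^ Suc n * ?S []"
      using mult_left_mono[OF xs(2) \<rho>(1)] by (simp add: mult.assoc)
    finally show ?case using path_prefix_snoc[OF xs(1), of a y] a by fastforce
  qed simp
  have "(\<lambda>n. \<rho> ^ n * ?S []) \<longlonglongrightarrow> 0"
    using tendsto_mult_right[OF LIMSEQ_realpow_zero[OF \<rho>], of "?S []"] by simp
  from order_tendstoD(2)[OF this \<epsilon>'(1)] obtain n where n: "\<rho> ^ n * ?S [] < \<epsilon>'"
    by (auto simp: eventually_sequentially)
  have "\<exists>xs\<in>set_pmf (?P (n + j)). (\<forall>i\<in>{n..<n + j}. fst (xs ! i) = a\<^sub>s) \<and> ?S xs < \<epsilon>'" for j
  proof (induction j)
    case 0
    then show ?case using shrink[of n] n by force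
  next
    case (Suc j)
    then obtain xs where xs: "xs \<in> set_pmf (?P (n + j))"
      "\<forall>i\<in>{n..<n + j}. fst (xs ! i) = a\<^sub>s" "?S xs < \<epsilon>'" by blast
    have "C * ?S xs \<le> C * \<epsilon>'" using xs(3) C(1) by (intro mult_left_mono) auto
    with C(2)[of "(e, xs)"] \<epsilon>'(3) have "0 < pmf (\<sigma> (e, xs)) a\<^sub>s" by linarith
    then have a: "a\<^sub>s \<in> set_pmf (\<sigma> (e, xs))" by (simp add: pmf_positive_iff)
    obtain y where y: "?S (xs @ [(a\<^sub>s, y)]) \<le> \<rho> * ?S xs" using step by blast
    have "\<rho> * ?S xs \<le> 1 * ?S xs"
      using \<rho> by (intro mult_right_mono sqrt_odds_nonneg) auto
    with y xs(3) have "?S (xs @ [(a\<^sub>s, y)]) < \<epsilon>'" by linarith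
    moreover have "\<forall>i\<in>{n..<n + Suc j}. fst ((xs @ [(a\<^sub>s, y)]) ! i) = a\<^sub>s"
      using xs(2) length_path_prefix[OF xs(1)] by (auto simp: nth_append less_Suc_eq)
    moreover have "xs @ [(a\<^sub>s, y)] \<in> set_pmf (?P (n + Suc j))"
      using path_prefix_snoc[OF xs(1), of a\<^sub>s y] a by simp
    ultimately show ?case by blast
  qed
  from this[of K] \<epsilon>'(2) that show ?thesis by fastforce
qed

section \<open>Runs of a single action\<close>

context
  fixes k\<^sub>s k K T :: nat and \<sigma> :: "('a, 'y) strategy" and e :: "nat \<Rightarrow> 'a" and a :: 'a
    and R :: "('a \<times> 'y) list \<Rightarrow> bool"
begin

text \<open>\<open>R\<close> conditions on the first \<open>T + K\<close> entries: it is trivial for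
  excluding limits and singles out one prefix for the frequency bound. The run starts at index
  \<open>T\<close>, so it already covers \<open>K\<close> entries when the estimates begin at length
  \<open>T + K\<close>.\<close>

definition action_run :: "('a \<times> 'y) list \<Rightarrow> bool" where
  "action_run zs \<longleftrightarrow> R (take (T + K) zs) \<and> (\<forall>i\<in>{T..<length zs}. fst (zs ! i) = a)"

definition run_prob :: "nat \<Rightarrow> real" where
  "run_prob n = measure_pmf.expectation (path_prefix F_star k\<^sub>s \<sigma> (e, []) n) (\<lambda>zs. of_bool (action_run zs))"

definition run_odds :: "nat \<Rightarrow> real" where
  "run_odds n = measure_pmf.expectation (path_prefix F_star k\<^sub>s \<sigma> (e, []) n)
     (\<lambda>zs. of_bool (action_run zs) * sqrt_odds k (e, zs))"

lemma action_run_snoc: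
  "T + K \<le> length zs \<Longrightarrow> action_run (zs @ [(b, y)]) \<longleftrightarrow> action_run zs \<and> b = a"
  by (auto simp: action_run_def nth_append less_Suc_eq Ball_def)

lemma run_prob_Suc:
  assumes "T + K \<le> n"
  shows "run_prob (Suc n) = measure_pmf.expectation (path_prefix F_star k\<^sub>s \<sigma> (e, []) n)
     (\<lambda>zs. of_bool (action_run zs) * pmf (\<sigma> (e, zs)) a)"
  unfolding run_prob_def expectation_path_prefix_Suc expectation_next_period
proof (rule expectation_pmf_cong)
  fix zs assume "zs \<in> set_pmf (path_prefix F_star k\<^sub>s \<sigma> (e, []) n)"
  then have "T + K \<le> length zs" using length_path_prefix assms by fastforce
  then show "(\<Sum>b\<in>UNIV. pmf (\<sigma> (fst (e, []), snd (e, []) @ zs)) b *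
      (\<Sum>y\<in>UNIV. pmf (F_star (lagged_action k\<^sub>s (fst (e, []), snd (e, []) @ zs) b)) y *
        of_bool (action_run (zs @ [(b, y)])))) = of_bool (action_run zs) * pmf (\<sigma> (e, zs)) a"
    by (subst sum.remove[of _ a]) (auto simp: action_run_snoc sum_pmf_eq_1)
qed

lemma run_prob_Suc_le:
  assumes "\<And>h. pmf (\<sigma> h) a \<le> C * sqrt_odds k h" "T + K \<le> n"
  shows "run_prob (Suc n) \<le> C * run_odds n"
proof -
  have "run_prob (Suc n) \<le> measure_pmf.expectation (path_prefix F_star k\<^sub>s \<sigma> (e, []) n)
     (\<lambda>zs. C * (of_bool (action_run zs) * sqrt_odds k (e, zs)))"
    unfolding run_prob_Suc[OF assms(2)]
    by (intro expectation_pmf_mono finite_set_path_prefix) (simp add: assms(1))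
  then show ?thesis by (simp add: run_odds_def)
qed

lemma run_prob_Suc_ge:
  assumes "\<And>h. 1 - pmf (\<sigma> h) a \<le> C * sqrt_odds k h" "T + K \<le> n"
  shows "run_prob n - C * run_odds n \<le> run_prob (Suc n)"
proof -
  let ?P = "path_prefix F_star k\<^sub>s \<sigma> (e, []) n"
  have "run_prob n - C * run_odds n = measure_pmf.expectation ?P
      (\<lambda>zs. of_bool (action_run zs) - C * (of_bool (action_run zs) * sqrt_odds k (e, zs)))"
    unfolding run_prob_def run_odds_def
    by (subst Bochner_Integration.integral_diff)
      (auto intro: integrable_measure_pmf_finite finite_set_path_prefix)
  also have "\<dots> \<le> run_prob (Suc n)"
    unfolding run_prob_Suc[OF assms(2)]
  proof (intro expectation_pmf_mono finite_set_path_prefix)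
    fix zs
    show "of_bool (action_run zs) - C * (of_bool (action_run zs) * sqrt_odds k (e, zs)) \<le>
        of_bool (action_run zs) * pmf (\<sigma> (e, zs)) a"
      using assms(1)[of "(e, zs)"] by (cases "action_run zs") auto
  qed
  finally show ?thesis .
qed

lemma run_odds_nonneg: "0 \<le> run_odds n"
  unfolding run_odds_def by (intro integral_nonneg_AE AE_I2) (simp add: sqrt_odds_nonneg)

lemma measure_action_run:
  "measure (path_measure F_star k\<^sub>s \<sigma> (e, []))
     {\<omega> \<in> space (path_measure F_star k\<^sub>s \<sigma> (e, [])). action_run (map \<omega> [0..<n])} = run_prob n"
proof -
  have "run_prob n = measure_pmf.expectation (path_prefix F_star k\<^sub>s \<sigma> (e, []) n)
      (indicator {zs. action_run zs})"
    unfolding run_prob_def by (rule expectation_pmf_cong) (simp add: indicator_def)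
  then show ?thesis by (simp add: measure_path_measure)
qed

text \<open>On the run event every period from \<open>T + K + 1\<close> to \<open>t\<close> counts.
  Periods start at 1 and list indices at 0, hence \<open>s - 1\<close>.\<close>

lemma frequency_ge:
  assumes "T + K \<le> t"
  shows "run_prob t * ((real t - real (T + K)) / real t) \<le>
    (\<integral>\<omega>. (1 / real t) * (\<Sum>s = 1..t. of_bool (path_action \<omega> s = a))
      \<partial>path_measure F_star k\<^sub>s \<sigma> (e, []))"
proof -
  let ?f = "\<lambda>zs. (1 / real t) * (\<Sum>s = 1..t. of_bool (fst (zs ! (s - 1)) = a))"
  have "run_prob t * ((real t - real (T + K)) / real t) =
      measure_pmf.expectation (path_prefix F_star k\<^sub>s \<sigma> (e, []) t)
        (\<lambda>zs. of_bool (action_run zs) * ((real t - real (T + K)) / real t))"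
    by (simp add: run_prob_def)
  also have "\<dots> \<le> measure_pmf.expectation (path_prefix F_star k\<^sub>s \<sigma> (e, []) t) ?f"
  proof (rule expectation_pmf_mono[OF finite_set_path_prefix])
    fix zs assume "zs \<in> set_pmf (path_prefix F_star k\<^sub>s \<sigma> (e, []) t)"
    then have len: "length zs = t" by (rule length_path_prefix)
    show "of_bool (action_run zs) * ((real t - real (T + K)) / real t) \<le> ?f zs"
    proof (cases "action_run zs")
      case True
      have "real t - real (T + K) = (\<Sum>s = Suc (T + K)..t. 1)" using assms by simp
      also have "\<dots> = (\<Sum>s = Suc (T + K)..t. of_bool (fst (zs ! (s - 1)) = a))"
      proof (rule sum.cong)
        fix s assume "s \<in> {Suc (T + K)..t}"
        then have "s - 1 \<in> {T..<length zs}" using len by auto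
        then have "fst (zs ! (s - 1)) = a" using True unfolding action_run_def by blast
        then show "1 = of_bool (fst (zs ! (s - 1)) = a)" by simp
      qed simp
      also have "\<dots> \<le> (\<Sum>s = 1..t. of_bool (fst (zs ! (s - 1)) = a))"
        by (intro sum_mono2) auto
      finally show ?thesis using True by (simp add: divide_right_mono)
    qed (simp add: sum_nonneg)
  qed
  also have "\<dots> = (\<integral>\<omega>. ?f (map \<omega> [0..<t]) \<partial>path_measure F_star k\<^sub>s \<sigma> (e, []))"
    by (rule integral_path_measure[symmetric])
  also have "(\<lambda>\<omega>. ?f (map \<omega> [0..<t])) =
      (\<lambda>\<omega>. (1 / real t) * (\<Sum>s = 1..t. of_bool (path_action \<omega> s = a)))"
    by (intro ext arg_cong2[where f = "(*)"] sum.cong) (auto simp: path_action_def)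
  finally show ?thesis .
qed

context
  fixes \<rho> :: real
  assumes lags: "k\<^sub>s \<le> K" "k \<le> K" and \<rho>: "0 \<le> \<rho>" "\<rho> < 1"
    and contr: "\<And>h b. (\<Sum>y\<in>UNIV. pmf (F_star (lagged_action k h b)) y *
      sqrt_odds k (fst h, snd h @ [(b, y)])) \<le> \<rho> * sqrt_odds k h"
begin

text \<open>The outcome is drawn with lag \<open>k\<^sub>s\<close>, whereas \<open>contr\<close>
  speaks of lag \<open>k\<close>; within a run both credit \<open>a\<close>. Any other action ends
  the run and contributes nothing.\<close>

lemma run_odds_Suc:
  assumes "T + K \<le> n"
  shows "run_odds (Suc n) \<le> \<rho> * run_odds n"
proof -
  have "run_odds (Suc n) \<le> measure_pmf.expectation (path_prefix F_star k\<^sub>s \<sigma> (e, []) n)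
      (\<lambda>zs. \<rho> * (of_bool (action_run zs) * sqrt_odds k (e, zs)))"
    unfolding run_odds_def expectation_path_prefix_Suc expectation_next_period
  proof (rule expectation_pmf_mono[OF finite_set_path_prefix])
    fix zs assume "zs \<in> set_pmf (path_prefix F_star k\<^sub>s \<sigma> (e, []) n)"
    then have len: "T + K \<le> length zs" using length_path_prefix assms by fastforce
    let ?X = "\<Sum>y\<in>UNIV. pmf (F_star (lagged_action k\<^sub>s (e, zs) a)) y * sqrt_odds k (e, zs @ [(a, y)])"
    have "(\<Sum>b\<in>UNIV. pmf (\<sigma> (e, zs)) b *
        (\<Sum>y\<in>UNIV. pmf (F_star (lagged_action k\<^sub>s (e, zs) b)) y *
          (of_bool (action_run (zs @ [(b, y)])) * sqrt_odds k (e, zs @ [(b, y)])))) =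
        of_bool (action_run zs) * (pmf (\<sigma> (e, zs)) a * ?X)"
      using len by (subst sum.remove[of _ a]) (auto simp: action_run_snoc)
    also have "\<dots> \<le> of_bool (action_run zs) * (1 * (\<rho> * sqrt_odds k (e, zs)))"
    proof (cases "action_run zs")
      case True
      have "lagged_action k\<^sub>s (e, zs) a = lagged_action k (e, zs) a"
        using True len lags by (simp add: action_run_def lagged_action_run[where T = T and K = K])
      then have X: "?X \<le> \<rho> * sqrt_odds k (e, zs)"
        using contr[of "(e, zs)" a] by simp
      have "0 \<le> ?X" by (intro sum_nonneg mult_nonneg_nonneg sqrt_odds_nonneg) auto
      then have "pmf (\<sigma> (e, zs)) a * ?X \<le> 1 * (\<rho> * sqrt_odds k (e, zs))"
        using X by (intro mult_mono) (auto simp: pmf_le_1)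
      then show ?thesis by simp
    qed simp
    finally show "(\<Sum>b\<in>UNIV. pmf (\<sigma> (fst (e, []), snd (e, []) @ zs)) b *
        (\<Sum>y\<in>UNIV. pmf (F_star (lagged_action k\<^sub>s (fst (e, []), snd (e, []) @ zs) b)) y *
          (of_bool (action_run (zs @ [(b, y)])) * sqrt_odds k (e, zs @ [(b, y)])))) \<le>
        \<rho> * (of_bool (action_run zs) * sqrt_odds k (e, zs))"
      by (simp add: mult.left_commute)
  qed
  then show ?thesis by (simp add: run_odds_def)
qed

lemma run_odds_le: "run_odds (T + K + m) \<le> \<rho> ^ m * run_odds (T + K)"
proof (induction m)
  case (Suc m)
  have "run_odds (T + K + Suc m) \<le> \<rho> * run_odds (T + K + m)" using run_odds_Suc[of "T + K + m"] by simp
  also have "\<dots> \<le> \<rho> ^ Suc m * run_odds (T + K)"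
    using mult_left_mono[OF Suc \<rho>(1)] by (simp add: mult.assoc)
  finally show ?case .
qed simp

text \<open>The loss in the period with offset \<open>j\<close> is at most
  \<open>C * \<rho> ^ j * run_odds (T + K)\<close>; these losses sum to at most the full geometric
  series.\<close>

lemma run_prob_ge:
  assumes "0 \<le> C" "\<And>h. 1 - pmf (\<sigma> h) a \<le> C * sqrt_odds k h"
  shows "run_prob (T + K) - C * run_odds (T + K) / (1 - \<rho>) \<le> run_prob (T + K + m)"
proof -
  have "run_prob (T + K) - C * run_odds (T + K) * (\<Sum>j<m. \<rho> ^ j) \<le> run_prob (T + K + m)"
  proof (induction m)
    case (Suc m)
    have "C * run_odds (T + K + m) \<le> C * (\<rho> ^ m * run_odds (T + K))"
      using assms(1) by (intro mult_left_mono run_odds_le)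
    with Suc run_prob_Suc_ge[OF assms(2), of "T + K + m"] show ?case
      by (simp add: algebra_simps)
  qed simp
  moreover have "(\<Sum>j<m. \<rho> ^ j) \<le> 1 / (1 - \<rho>)"
    using sum_le_suminf[of "\<lambda>j. \<rho> ^ j" "{..<m}"] \<rho> by (simp add: suminf_geometric summable_geometric)
  then have "C * run_odds (T + K) * (\<Sum>j<m. \<rho> ^ j) \<le> C * run_odds (T + K) * (1 / (1 - \<rho>))"
    using assms(1) run_odds_nonneg by (intro mult_left_mono) auto
  ultimately show ?thesis by simp
qed

text \<open>Here the odds bound the probability of \<open>a\<close> itself, so the decay of the odds
  along the run forces the run to end.\<close>

lemma run_prob_tendsto_0:
  assumes "\<And>h. pmf (\<sigma> h) a \<le> C * sqrt_odds k h" "0 \<le> C"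
  shows "(\<lambda>m. run_prob (Suc (T + K + m))) \<longlonglongrightarrow> 0"
proof (rule tendsto_sandwich[where f = "\<lambda>_. 0" and h = "\<lambda>m. C * (\<rho> ^ m * run_odds (T + K))"])
  have "run_prob (Suc (T + K + m)) \<le> C * (\<rho> ^ m * run_odds (T + K))" for m
  proof -
    have "run_prob (Suc (T + K + m)) \<le> C * run_odds (T + K + m)"
      by (rule run_prob_Suc_le) (simp_all add: assms(1))
    also have "\<dots> \<le> C * (\<rho> ^ m * run_odds (T + K))"
      using assms(2) by (intro mult_left_mono run_odds_le)
    finally show ?thesis .
  qed
  then show "\<forall>\<^sub>F m in sequentially. run_prob (Suc (T + K + m)) \<le> C * (\<rho> ^ m * run_odds (T + K))"
    by simp
  show "(\<lambda>m. C * (\<rho> ^ m * run_odds (T + K))) \<longlonglongrightarrow> 0"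
    using tendsto_mult_left[OF tendsto_mult_right[OF LIMSEQ_realpow_zero[OF \<rho>], of "run_odds (T + K)"], of C]
    by simp
  show "\<forall>\<^sub>F m in sequentially. 0 \<le> run_prob (Suc (T + K + m))"
    unfolding run_prob_def by (intro always_eventually allI integral_nonneg_AE AE_I2) simp
qed simp

end

end

section \<open>Exclusion of wrong limits and the frequency bound\<close>

lemma no_convergence:
  assumes \<rho>: "0 \<le> \<rho>" "\<rho> < 1"
    and contr: "\<And>h b. (\<Sum>y\<in>UNIV. pmf (F_star (lagged_action k h b)) y *
      sqrt_odds k (fst h, snd h @ [(b, y)])) \<le> \<rho> * sqrt_odds k h"
    and C: "0 \<le> C" "\<And>h. pmf (\<sigma> h) a \<le> C * sqrt_odds k h"
  shows "measure (path_measure F_star k\<^sub>s \<sigma> (e, []))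
    {\<omega> \<in> space (path_measure F_star k\<^sub>s \<sigma> (e, [])). actions_converge_to \<omega> a} = 0"
proof -
  let ?M = "path_measure F_star k\<^sub>s \<sigma> (e, [])"
  interpret M: prob_space ?M by (rule prob_space_path_measure)
  let ?K = "max k\<^sub>s k"
  \<comment> \<open>Convergence in a discrete set means being eventually constant, so the event is
    the countable union of the \<open>A T\<close>. Each of these lies in every \<open>E T n\<close>
    and is therefore null.\<close>
  define E where "E T n = {\<omega> \<in> space ?M. action_run ?K T a (\<lambda>_. True) (map \<omega> [0..<n])}" for T n
  define A where "A T = (\<Inter>n. E T n)" for T
  have E_sets: "E T n \<in> sets ?M" for T n
    using measurable_sets[OF measurable_map_upt_path_measure,
        of "{zs. action_run ?K T a (\<lambda>_. True) zs}" n F_star k\<^sub>s \<sigma> "(e, [])"]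
    by (simp add: E_def vimage_def Int_def conj_commute)
  have "A T \<in> null_sets ?M" for T
  proof -
    have A_sets: "A T \<in> sets ?M" unfolding A_def using E_sets by (intro sets.countable_INT') auto
    have "M.prob (A T) \<le> run_prob k\<^sub>s ?K T \<sigma> e a (\<lambda>_. True) n" for n
    proof -
      have "A T \<subseteq> E T n" unfolding A_def by blast
      then have "M.prob (A T) \<le> M.prob (E T n)" by (rule M.finite_measure_mono[OF _ E_sets])
      also have "\<dots> = run_prob k\<^sub>s ?K T \<sigma> e a (\<lambda>_. True) n"
        unfolding E_def by (rule measure_action_run)
      finally show ?thesis .
    qed
    then have "M.prob (A T) \<le> 0"
      by (intro LIMSEQ_le_const[OF run_prob_tendsto_0[OF _ _ \<rho> contr C(2,1),
            of k\<^sub>s ?K T e "\<lambda>_. True"]]) auto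
    then have "M.prob (A T) = 0" by (simp add: measure_le_0_iff)
    with A_sets show ?thesis by (auto simp: null_sets_def M.emeasure_eq_measure)
  qed
  then have "(\<Union>T. A T) \<in> null_sets ?M" by (rule null_sets_UN)
  moreover have "{\<omega> \<in> space ?M. actions_converge_to \<omega> a} = (\<Union>T. A T)"
  proof -
    have "actions_converge_to \<omega> a \<longleftrightarrow> (\<exists>T. \<forall>i\<ge>T. fst (\<omega> i) = a)" for \<omega> :: "nat \<Rightarrow> 'a \<times> 'y"
    proof -
      \<comment> \<open>The shift avoids the truncated subtraction in \<open>path_action\<close> at
        0.\<close>
      have "actions_converge_to \<omega> a \<longleftrightarrow> (\<forall>\<^sub>F i in sequentially. path_action \<omega> (Suc i) = a)"
        unfolding actions_converge_to_def by (rule eventually_sequentially_Suc[symmetric])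
      then show ?thesis by (simp add: path_action_def eventually_sequentially)
    qed
    moreover have "(\<forall>i\<ge>T. fst (\<omega> i) = a) \<longleftrightarrow> (\<forall>n. \<forall>i\<in>{T..<n}. fst (\<omega> i) = a)"
      for T and \<omega> :: "nat \<Rightarrow> 'a \<times> 'y" by (meson atLeastLessThan_iff lessI)
    ultimately have conv: "actions_converge_to \<omega> a \<longleftrightarrow> (\<exists>T. \<forall>n. \<forall>i\<in>{T..<n}. fst (\<omega> i) = a)"
      for \<omega> :: "nat \<Rightarrow> 'a \<times> 'y"
      by (simp only:)
    show ?thesis
      unfolding conv by (auto simp: A_def E_def action_run_def)
  qed
  ultimately show ?thesis by (simp add: measure_eq_0_null_sets)
qed

text \<open>Condition on one prefix \<open>xs\<close> of probability \<open>w\<close> with small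
  odds. At most half of \<open>w\<close> is lost in the whole subsequent run, and for large
  \<open>t\<close> the run covers at least half of the periods, which gives the bound
  \<open>w / 4\<close>.\<close>

lemma frequency_liminf_pos:
  assumes \<rho>: "0 \<le> \<rho>" "\<rho> < 1"
    and contr: "\<And>h b. (\<Sum>y\<in>UNIV. pmf (F_star (lagged_action k h b)) y *
      sqrt_odds k (fst h, snd h @ [(b, y)])) \<le> \<rho> * sqrt_odds k h"
    and C: "0 \<le> C" "\<And>h. 1 - pmf (\<sigma> h) a \<le> C * sqrt_odds k h"
  shows "0 < liminf (\<lambda>t. ereal (\<integral>\<omega>. (1 / real t) *
             (\<Sum>s = 1..t. of_bool (path_action \<omega> s = a)) \<partial>path_measure F_star k\<^sub>s \<sigma> (e, [])))"
proof -
  let ?K = "max k\<^sub>s k" and ?P = "path_prefix F_star k\<^sub>s \<sigma> (e, [])"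
  \<comment> \<open>Chosen so that the geometric series of losses is at most one half, relative to
    the probability of the prefix.\<close>
  define \<epsilon> where "\<epsilon> = (1 - \<rho>) / (2 * (C + 1))"
  have "0 < \<epsilon>" using \<rho> C(1) by (simp add: \<epsilon>_def)
  have C\<epsilon>: "C * \<epsilon> / (1 - \<rho>) \<le> 1 / 2" 
  proof -
    have "C * \<epsilon> / (1 - \<rho>) = C / (2 * (C + 1))" using \<rho> by (simp add: \<epsilon>_def)
    also have "\<dots> \<le> 1 / 2" using C(1) by (simp add: field_simps)
    finally show ?thesis .
  qed
  obtain T xs where xs: "xs \<in> set_pmf (?P (T + ?K))"
    "\<forall>i\<in>{T..<T + ?K}. fst (xs ! i) = a" "sqrt_odds k (e, xs) < \<epsilon>"
    using exists_learning_prefix[OF \<rho> contr C \<open>0 < \<epsilon>\<close>] by blast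
  let ?R = "\<lambda>zs. zs = xs"
  let ?p = "run_prob k\<^sub>s ?K T \<sigma> e a ?R" and ?q = "run_odds k\<^sub>s k ?K T \<sigma> e a ?R"
  define w where "w = pmf (?P (T + ?K)) xs"
  have "0 < w" using xs(1) by (simp add: w_def pmf_positive_iff)
  \<comment> \<open>At length \<open>T + ?K\<close> the run event is just the prefix
    \<open>xs\<close>, so expectations reduce to one term.\<close>
  have single: "measure_pmf.expectation (?P (T + ?K)) (\<lambda>zs. of_bool (action_run ?K T a ?R zs) * f zs) =
      w * f xs" for f
  proof -
    have "measure_pmf.expectation (?P (T + ?K)) (\<lambda>zs. of_bool (action_run ?K T a ?R zs) * f zs) =
        measure_pmf.expectation (?P (T + ?K)) (\<lambda>zs. indicator {xs} zs * f xs)"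
    proof (rule expectation_pmf_cong)
      fix zs assume "zs \<in> set_pmf (?P (T + ?K))"
      then have "length zs = T + ?K" by (rule length_path_prefix)
      then have "action_run ?K T a ?R zs \<longleftrightarrow> zs = xs" using xs(2) by (auto simp: action_run_def)
      then show "of_bool (action_run ?K T a ?R zs) * f zs = indicator {xs} zs * f xs" by simp
    qed
    then show ?thesis by (simp add: w_def pmf.rep_eq)
  qed
  have p: "?p (T + ?K) = w" using single[of "\<lambda>_. 1"] by (simp add: run_prob_def)
  have q: "?q (T + ?K) = w * sqrt_odds k (e, xs)" by (simp add: run_odds_def single)
  have p_ge: "w / 2 \<le> ?p t" if "T + ?K \<le> t" for t
  proof -
    have "C * (w * sqrt_odds k (e, xs)) / (1 - \<rho>) \<le> C * (w * \<epsilon>) / (1 - \<rho>)"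
      using xs(3) \<open>0 < w\<close> C(1) \<rho> by (intro divide_right_mono mult_left_mono) auto
    also have "\<dots> = w * (C * \<epsilon> / (1 - \<rho>))" by simp
    also have "\<dots> \<le> w * (1 / 2)" using \<open>0 < w\<close> by (intro mult_left_mono C\<epsilon>) simp
    finally have "w / 2 \<le> ?p (T + ?K) - C * ?q (T + ?K) / (1 - \<rho>)" unfolding p q by simp
    also have "\<dots> \<le> ?p (T + ?K + (t - (T + ?K)))"
      by (rule run_prob_ge[OF _ _ \<rho> contr C]) auto
    finally show ?thesis using that by simp
  qed
  have "ereal (w / 4) \<le> ereal (\<integral>\<omega>. (1 / real t) *
      (\<Sum>s = 1..t. of_bool (path_action \<omega> s = a)) \<partial>path_measure F_star k\<^sub>s \<sigma> (e, []))"
    if t: "2 * (T + ?K) + 1 \<le> t" for t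
  proof -
    have "real (2 * (T + ?K)) \<le> real t" using t by (intro of_nat_mono) simp
    then have "1 / 2 \<le> (real t - real (T + ?K)) / real t"
      using t by (simp add: pos_le_divide_eq)
    then have "w / 2 * (1 / 2) \<le> ?p t * ((real t - real (T + ?K)) / real t)"
      using p_ge[of t] t \<open>0 < w\<close> by (intro mult_mono) auto
    also have "\<dots> \<le> (\<integral>\<omega>. (1 / real t) *
      (\<Sum>s = 1..t. of_bool (path_action \<omega> s = a)) \<partial>path_measure F_star k\<^sub>s \<sigma> (e, []))"
      by (rule frequency_ge) (use t in simp)
    finally show ?thesis by simp
  qed
  then have "ereal (w / 4) \<le> liminf (\<lambda>t. ereal (\<integral>\<omega>. (1 / real t) *
      (\<Sum>s = 1..t. of_bool (path_action \<omega> s = a)) \<partial>path_measure F_star k\<^sub>s \<sigma> (e, [])))"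
    by (intro Liminf_bounded) (auto simp: eventually_sequentially)
  moreover have "0 < ereal (w / 4)" using \<open>0 < w\<close> by simp
  ultimately show ?thesis by (rule less_le_trans[rotated])
qed

end

theorem lemma3p1:
  fixes v :: "'y::finite \<Rightarrow> real"
    and k_star k' :: nat
    and F_star :: "('a::finite, 'y) state"
    and a_star :: 'a
    and \<delta> :: real
    and \<pi>\<^sub>0 :: "('a, 'y) state pmf"
    and e :: "nat \<Rightarrow> 'a"
  assumes "k_star \<noteq> k'"
    and "\<forall>a. is_arg_max (expected_payoff v F_star) (\<lambda>_. True) a \<longleftrightarrow> a = a_star"
    and "(0 < \<delta> \<and> \<delta> < 1) \<or> (\<delta> = 0 \<and> k' = 0)"
    and "regular_prior F_star \<pi>\<^sub>0"
  shows "\<forall>\<sigma> \<in> optimal_strategies \<delta> v k' \<pi>\<^sub>0.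
      (\<forall>a. 0 < measure (path_measure F_star k_star \<sigma> (e, []))
                 {\<omega> \<in> space (path_measure F_star k_star \<sigma> (e, [])). actions_converge_to \<omega> a}
           \<longrightarrow> a = a_star) \<and>
      0 < liminf (\<lambda>t. ereal (\<integral>\<omega>. (1 / real t) *
             (\<Sum>s = 1..t. of_bool (path_action \<omega> s = a_star))
             \<partial>path_measure F_star k_star \<sigma> (e, [])))"
proof (intro ballI)
  interpret regular_learning F_star \<pi>\<^sub>0
    using assms(4) by (simp add: regular_learning_def)
  fix \<sigma> assume "\<sigma> \<in> optimal_strategies \<delta> v k' \<pi>\<^sub>0"
  then obtain C where C: "0 \<le> C" "\<And>h. 1 - pmf (\<sigma> h) a_star \<le> C * sqrt_odds k' h"
    using optimal_choice_bound[OF _ assms(2,3)] by blast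
  obtain \<rho> where \<rho>: "0 \<le> \<rho>" "\<rho> < 1" and contr:
    "\<And>k h a. (\<Sum>y\<in>UNIV. pmf (F_star (lagged_action k h a)) y *
        sqrt_odds k (fst h, snd h @ [(a, y)])) \<le> \<rho> * sqrt_odds k h"
    by (rule sqrt_odds_contraction) (rule that)
  \<comment> \<open>A wrong action has at most the mass missing from \<open>a_star\<close>, which
    turns the bound on wrong choices into the hypothesis of \<open>no_convergence\<close>.\<close>
  have other: "pmf (\<sigma> h) a \<le> C * sqrt_odds k' h" if "a \<noteq> a_star" for a h
  proof -
    have "pmf (\<sigma> h) a + pmf (\<sigma> h) a_star = (\<Sum>b\<in>{a, a_star}. pmf (\<sigma> h) b)" using that by simp
    also have "\<dots> \<le> (\<Sum>b\<in>UNIV. pmf (\<sigma> h) b)" by (rule sum_mono2) auto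
    also have "\<dots> = 1" by (simp add: sum_pmf_eq_1)
    finally show ?thesis using C(2)[of h] by linarith
  qed
  let ?M = "path_measure F_star k_star \<sigma> (e, [])"
  have "a = a_star" if "0 < measure ?M {\<omega> \<in> space ?M. actions_converge_to \<omega> a}" for a
  proof (rule ccontr)
    assume "a \<noteq> a_star"
    from no_convergence[OF \<rho> contr C(1) other[OF this]] that show False by simp
  qed
  with frequency_liminf_pos[OF \<rho> contr C]
  show "(\<forall>a. 0 < measure ?M {\<omega> \<in> space ?M. actions_converge_to \<omega> a} \<longrightarrow> a = a_star) \<and>
      0 < liminf (\<lambda>t. ereal (\<integral>\<omega>. (1 / real t) *
             (\<Sum>s = 1..t. of_bool (path_action \<omega> s = a_star)) \<partial>?M))" by blast
qed

end
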